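(* Let $X=(X_t)_{t\ge 0}$ be a subordinator with $\mathbb{P}\{X_1=0\}<1$. (a) If $X$ is not a compound Poisson process, then for every $a>0$, $$\mathbb{E}[e^{aT_r}]<\infty\quad\text{for all } r\ge 0.$$ (b) If $X$ is a compound Poisson process (with positive jumps) of rate $\lambda>0$, then for $a>0$ the following conditions are equivalent: (i) $\mathbb{E}[e^{aT_r}]<\infty$ for some $r\ge 0$; (ii) $\mathbb{E}[e^{aT_r}]<\infty$ for every $r\ge 0$; (iii) $a<\lambda$. In both cases (a) and (b), the same statements also hold with $T_r$ replaced by $N_r$, and with $T_r$ replaced by $\varrho_r$.
   Context: A Lévy process $X=(X_t)_{t\ge0}$ on $\mathbb{R}$ is a stochastically continuous process with independent and stationary increments and $X_0=0$; its paths are assumed right-continuous with finite left limits. A subordinator is a Lévy process with nondecreasing paths a.s. (no killing). A compound Poisson process of rate $\lambda>0$ with positive jumps is $X_t=\sum_{k=1}^{N(t)}Y_k$, where $(N(t))_{t\ge0}$ is a Poisson process of rate $\lambda$ independent of the i.i.d. sequence $(Y_k)_{k\ge1}$ of (strictly) positive random variables (in particular there is no drift). For $r\ge0$: $T_r:=\inf\{t\ge0: X_t>r\}$ (with $\inf\varnothing=\infty$) is the first passage time into $(r,\infty)$; $N_r:=\int_0^\infty \mathbf{1}_{\{X_t\le r\}}\,dt$ is the sojourn time in $(-\infty,r]$; $\varrho_r:=\sup\{t\ge0: X_t\le r\}$ is the last exit time from $(-\infty,r]$. *)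

theory Defs
  imports "HOL-Probability.Probability"
begin

text \<open>
  A real-valued process in continuous time is a function \<open>X :: real \<Rightarrow> 'a \<Rightarrow> real\<close> that
  is only inspected at times \<open>t \<ge> 0\<close>; values at negative times are junk.
\<close>

locale levy_process = prob_space M for M :: "'a measure" +
  fixes X :: "real \<Rightarrow> 'a \<Rightarrow> real"
  assumes random_variables: "\<And>t. 0 \<le> t \<Longrightarrow> random_variable borel (X t)"
    and start_zero: "\<And>\<omega>. \<omega> \<in> space M \<Longrightarrow> X 0 \<omega> = 0"
    and independent_increments:
      "\<And>(t :: nat \<Rightarrow> real) n. 0 \<le> t 0 \<Longrightarrow> (\<And>i. i < n \<Longrightarrow> t i < t (Suc i)) \<Longrightarrow>
         indep_vars (\<lambda>_. borel) (\<lambda>i \<omega>. X (t (Suc i)) \<omega> - X (t i) \<omega>) {..<n}"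
    and stationary_increments:
      "\<And>s t. 0 \<le> s \<Longrightarrow> s \<le> t \<Longrightarrow>
         distr M borel (\<lambda>\<omega>. X t \<omega> - X s \<omega>) = distr M borel (X (t - s))"
    and stochastically_continuous:
      "\<And>t \<epsilon>. 0 \<le> t \<Longrightarrow> 0 < \<epsilon> \<Longrightarrow>
         ((\<lambda>s. prob {\<omega> \<in> space M. \<epsilon> < \<bar>X s \<omega> - X t \<omega>\<bar>}) \<longlongrightarrow> 0) (at t within {0..})"
    and right_continuous:
      "\<And>\<omega> t. \<omega> \<in> space M \<Longrightarrow> 0 \<le> t \<Longrightarrow> continuous (at_right t) (\<lambda>s. X s \<omega>)"
    and left_limits:
      "\<And>\<omega> t. \<omega> \<in> space M \<Longrightarrow> 0 < t \<Longrightarrow> \<exists>l. ((\<lambda>s. X s \<omega>) \<longlongrightarrow> l) (at_left t)"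

locale subordinator = levy_process M X for M :: "'a measure" and X +
  assumes nondecreasing: "AE \<omega> in M. \<forall>s t. 0 \<le> s \<longrightarrow> s \<le> t \<longrightarrow> X s \<omega> \<le> X t \<omega>"

text \<open>
  The Poisson process is the Levy process with values in \<open>\<nat>\<close> and Poisson distributed marginals.
  The constant \<open>poisson_pmf\<close> is meaningful for positive rates only, hence \<open>0 < t\<close>.
\<close>

locale poisson_process = levy_process M "\<lambda>t \<omega>. real (N t \<omega>)"
  for M :: "'a measure" and N :: "real \<Rightarrow> 'a \<Rightarrow> nat" +
  fixes rate :: real
  assumes rate_pos: "0 < rate"
    and poisson_distributed:
      "\<And>t. 0 < t \<Longrightarrow>
         distr M (count_space UNIV) (N t) = measure_pmf (poisson_pmf (rate * t))"

text \<open>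
  The independence assumption concerns the \<open>\<sigma>\<close>-algebra generated by the whole counting process
  and the one generated by the whole sequence of jumps; \<open>indep_var\<close> is not applicable, because
  the two random elements have different types. The process \<open>X\<close> is required to agree with the
  random sum up to indistinguishability, so that null sets do not matter.
\<close>

locale compound_poisson_representation =
  poisson_process M N rate for M :: "'a measure" and N rate +
  fixes X :: "real \<Rightarrow> 'a \<Rightarrow> real"
    and Y :: "nat \<Rightarrow> 'a \<Rightarrow> real"
  assumes jumps_independent: "indep_vars (\<lambda>_. borel) Y {1..}"
    and jumps_identically_distributed:
      "\<And>k. 1 \<le> k \<Longrightarrow> distr M borel (Y k) = distr M borel (Y 1)"
    and jumps_positive: "\<And>k. 1 \<le> k \<Longrightarrow> AE \<omega> in M. 0 < Y k \<omega>"
    and count_independent_of_jumps: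
      "indep_set
         (sets (vimage_algebra (space M) (\<lambda>\<omega>. \<lambda>t\<in>{0..}. N t \<omega>)
            (\<Pi>\<^sub>M t\<in>{0..}. count_space UNIV)))
         (sets (vimage_algebra (space M) (\<lambda>\<omega>. \<lambda>k\<in>{1..}. Y k \<omega>)
            (\<Pi>\<^sub>M k\<in>{1..}. borel)))"
    and random_sum: "AE \<omega> in M. \<forall>t\<ge>0. X t \<omega> = (\<Sum>k = 1..N t \<omega>. Y k \<omega>)"

definition compound_poisson_process ::
    "'a measure \<Rightarrow> (real \<Rightarrow> 'a \<Rightarrow> real) \<Rightarrow> real \<Rightarrow> bool" where
  "compound_poisson_process M X rate \<longleftrightarrow>
     (\<exists>N Y. compound_poisson_representation M N rate X Y)"

text \<open>
  The three functionals take values in \<open>[0, \<infinity>]\<close>, where the infimum of the empty set is \<open>\<infinity>\<close>.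
\<close>

definition first_passage_time :: "(real \<Rightarrow> 'a \<Rightarrow> real) \<Rightarrow> real \<Rightarrow> 'a \<Rightarrow> ennreal" where
  "first_passage_time X r \<omega> = Inf {ennreal t |t. 0 \<le> t \<and> r < X t \<omega>}"

definition sojourn_time :: "(real \<Rightarrow> 'a \<Rightarrow> real) \<Rightarrow> real \<Rightarrow> 'a \<Rightarrow> ennreal" where
  "sojourn_time X r \<omega> = (\<integral>\<^sup>+t\<in>{0..}. indicator {t. X t \<omega> \<le> r} t \<partial>lborel)"

definition last_exit_time :: "(real \<Rightarrow> 'a \<Rightarrow> real) \<Rightarrow> real \<Rightarrow> 'a \<Rightarrow> ennreal" where
  "last_exit_time X r \<omega> = Sup {ennreal t |t. 0 \<le> t \<and> X t \<omega> \<le> r}"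

definition exp_ennreal :: "ennreal \<Rightarrow> ennreal" where
  "exp_ennreal x = (if x = \<infinity> then \<infinity> else ennreal (exp (enn2real x)))"

definition exp_moment :: "'a measure \<Rightarrow> real \<Rightarrow> ('a \<Rightarrow> ennreal) \<Rightarrow> ennreal" where
  "exp_moment M a T = (\<integral>\<^sup>+\<omega>. exp_ennreal (ennreal a * T \<omega>) \<partial>M)"

end

theory Submission
  imports Defs
begin

text \<open>
  Almost every path of a subordinator is nondecreasing, so the set of times at which
  \<open>X \<le> r\<close> is an interval starting at 0, and first passage time, sojourn time and last exit
  time are all caught between the same consecutive integers \<open>m\<close> and \<open>m + 1\<close> with
  \<open>X m \<le> r < X (m + 1)\<close>. Up to constant factors the exponential moment is therefore the series
  \<open>\<Sum>n. exp (a n) P(X n \<le> r)\<close>. The Chernoff bound \<open>P(X n \<le> r) \<le> exp (s r) \<phi>(s)^n\<close>, where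
  \<open>\<phi>(s) = E exp (-s X 1)\<close>, and the limit of \<open>\<phi>(s)\<close> to \<open>p = P(X 1 = 0)\<close> for \<open>s \<rightarrow> \<infinity>\<close> show that the
  series converges as soon as \<open>exp a * p < 1\<close> (lemma \<open>exp_moment_finite\<close>). A compound Poisson
  process of rate \<open>c\<close> has \<open>P(X n = 0) = exp (-c n)\<close>, so that the series converges for \<open>a < c\<close>, and
  for \<open>a \<ge> c\<close> its terms do not even tend to 0 (\<open>exp_moment_infinite\<close>).

  This leaves a subordinator with \<open>p < 1\<close> that is not compound Poisson, where the claim for all
  \<open>a\<close> amounts to \<open>p = 0\<close>. In other words: if \<open>0 < p < 1\<close>, then \<open>X\<close> is a compound Poisson process
  of rate \<open>c = - ln p\<close>, with a counting process and jumps that live on the given probability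
  space (\<open>is_compound_poisson\<close>). The proof compares \<open>X\<close> with its restriction to the grid of mesh
  \<open>1/(n+1)\<close>. Its increments are independent and vanish with probability \<open>exp (-c/(n+1))\<close>, so the
  expected number of nonzero increments up to time \<open>T\<close> is bounded by \<open>c T\<close> for all \<open>n\<close>. By Fatou's
  lemma almost every path takes finitely many values on bounded intervals, hence is a step
  function. For such a path the grid eventually separates the jumps: the number of nonzero
  increments and their sizes are eventually \<^emph>\<open>equal\<close> to the number and the sizes of the jumps
  (\<open>grid_jumps\<close>). Probabilities of arbitrary events, not only of continuity sets, thus
  pass to the limit (\<open>prob_tendsto_of_eventually_eq\<close>).
  On the grid everything is elementary: counts over disjoint blocks are independent and binomial,
  and given the positions of the nonzero increments, their sizes are independent with the law of
  an increment conditioned not to vanish (\<open>marks_prob\<close>). In the limit the number of jumps has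
  independent Poisson increments, and the jump sizes are independent, identically distributed and
  independent of the number of jumps.
\<close>

section \<open>Grids of mesh 1/(n+1)\<close>

definition grid :: "nat \<Rightarrow> nat \<Rightarrow> real" where
  "grid n j = real j / real (Suc n)"

text \<open>
  The number of grid cells that start before time \<open>t\<close>. Rounding up places the last grid point
  at or after \<open>t\<close>, where right-continuity controls the path.
\<close>

definition cells :: "nat \<Rightarrow> real \<Rightarrow> nat" where
  "cells n t = nat \<lceil>t * real (Suc n)\<rceil>"

lemma grid_nonneg [simp]: "0 \<le> grid n j"
  by (simp add: grid_def)

lemma grid_0 [simp]: "grid n 0 = 0"
  by (simp add: grid_def)

lemma grid_mono: "i \<le> j \<Longrightarrow> grid n i \<le> grid n j"
  by (simp add: grid_def divide_right_mono)

lemma grid_Suc: "grid n (Suc j) = grid n j + 1 / real (Suc n)"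
  by (simp add: grid_def add_divide_distrib)

lemma cells_mono: "s \<le> t \<Longrightarrow> cells n s \<le> cells n t"
  unfolding cells_def by (intro nat_mono ceiling_mono mult_right_mono) auto

lemma grid_cells:
  assumes "0 \<le> t"
  shows "t \<le> grid n (cells n t)" "grid n (cells n t) < t + 1 / real (Suc n)"
proof -
  have eq: "real (cells n t) = of_int \<lceil>t * real (Suc n)\<rceil>"
    using assms by (simp add: cells_def)
  have "t * real (Suc n) \<le> real (cells n t)"
    unfolding eq by linarith
  then show "t \<le> grid n (cells n t)"
    by (simp add: grid_def pos_le_divide_eq del: of_nat_Suc)
  have "real (cells n t) < t * real (Suc n) + 1"
    unfolding eq by linarith
  then have "real (cells n t) / real (Suc n) < (t * real (Suc n) + 1) / real (Suc n)"
    by (intro divide_strict_right_mono) auto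
  also have "\<dots> = t + 1 / real (Suc n)"
    by (simp add: field_simps)
  finally show "grid n (cells n t) < t + 1 / real (Suc n)"
    by (simp add: grid_def)
qed

lemma grid_le_1: "1 / real (Suc n) \<le> 1"
  by simp

lemma LIMSEQ_mesh: "(\<lambda>n. 1 / real (Suc n)) \<longlonglongrightarrow> 0"
  using LIMSEQ_inverse_real_of_nat by (simp add: divide_inverse)

lemma grid_cells_tendsto:
  assumes "0 \<le> t"
  shows "(\<lambda>n. grid n (cells n t)) \<longlonglongrightarrow> t"
proof (rule tendsto_sandwich[where f = "\<lambda>_. t" and h = "\<lambda>n. t + 1 / real (Suc n)"])
  show "(\<lambda>n. t + 1 / real (Suc n)) \<longlonglongrightarrow> t"
    using tendsto_add[OF tendsto_const LIMSEQ_mesh, of t] by simp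
qed (use grid_cells[OF assms] in \<open>auto intro!: always_eventually less_imp_le\<close>)

section \<open>Nonzero steps and their ranks\<close>

definition grid_increment :: "(real \<Rightarrow> real) \<Rightarrow> nat \<Rightarrow> nat \<Rightarrow> real" where
  "grid_increment x n j = x (grid n (Suc j)) - x (grid n j)"

definition nonzeros :: "(nat \<Rightarrow> real) \<Rightarrow> nat \<Rightarrow> nat set" where
  "nonzeros \<xi> m = {j. j < m \<and> \<xi> j \<noteq> 0}"

definition rank_in :: "nat set \<Rightarrow> nat \<Rightarrow> nat" where
  "rank_in S j = card {i \<in> S. i \<le> j}"

lemma finite_nonzeros [simp]: "finite (nonzeros \<xi> m)"
  by (simp add: nonzeros_def)

lemma rank_insert_max:
  assumes "finite S" "\<forall>a\<in>S. a < b"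
  shows "rank_in (insert b S) b = Suc (card S)" "\<And>a. a \<in> S \<Longrightarrow> rank_in (insert b S) a = rank_in S a"
proof -
  have "{i \<in> insert b S. i \<le> b} = insert b S" using assms by auto
  moreover have "b \<notin> S" using assms by auto
  ultimately show "rank_in (insert b S) b = Suc (card S)"
    using assms by (simp add: rank_in_def)
  fix a assume "a \<in> S"
  then have "{i \<in> insert b S. i \<le> a} = {i \<in> S. i \<le> a}" using assms by fastforce
  then show "rank_in (insert b S) a = rank_in S a" by (simp add: rank_in_def)
qed

text \<open>
  Ranks turn a condition on the \<open>k\<close>-th element of \<open>S\<close>, for all \<open>k\<close>, into a condition on each element
  by itself. This keeps the events about the \<open>k\<close>-th nonzero step in product form.
\<close>

lemma bij_betw_rank: "finite S \<Longrightarrow> bij_betw (rank_in S) S {1..card S}"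
proof (induction S rule: finite_linorder_max_induct)
  case empty
  then show ?case by (simp add: bij_betw_def)
next
  case (insert b A)
  have b: "b \<notin> A" using insert by auto
  have "bij_betw (rank_in (insert b A)) A {1..card A} \<longleftrightarrow> bij_betw (rank_in A) A {1..card A}"
    using insert by (intro bij_betw_cong) (auto simp: rank_insert_max)
  then have "bij_betw (rank_in (insert b A)) A {1..card A}"
    using insert by simp
  then have "bij_betw (rank_in (insert b A)) (A \<union> {b}) ({1..card A} \<union> {rank_in (insert b A) b})"
    using insert b by (intro iffD1[OF notIn_Un_bij_betw3]) (auto simp: rank_insert_max)
  moreover have "{1..card A} \<union> {rank_in (insert b A) b} = {1..card (insert b A)}"
    using insert b by (auto simp: rank_insert_max)
  ultimately show ?case by simp
qed

lemma nonzeros_Suc: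
  "nonzeros \<xi> (Suc m) = (if \<xi> m \<noteq> 0 then insert m (nonzeros \<xi> m) else nonzeros \<xi> m)"
  by (auto simp: nonzeros_def less_Suc_eq)

lemma nonzeros_less: "\<forall>a\<in>nonzeros \<xi> m. a < m"
  by (simp add: nonzeros_def)

lemma card_nonzeros_Suc:
  "card (nonzeros \<xi> (Suc m)) = card (nonzeros \<xi> m) + (if \<xi> m \<noteq> 0 then 1 else 0)"
  using nonzeros_less[of \<xi> m] by (auto simp: nonzeros_Suc card_insert_if)

lemma rank_nonzeros:
  assumes "j \<in> nonzeros \<xi> m"
  shows "rank_in (nonzeros \<xi> m) j = card (nonzeros \<xi> (Suc j))"
proof -
  have "{i \<in> nonzeros \<xi> m. i \<le> j} = nonzeros \<xi> (Suc j)"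
    using assms by (auto simp: nonzeros_def)
  then show ?thesis by (simp add: rank_in_def)
qed

text \<open>
  Every new value along the grid costs a nonzero increment.
\<close>

lemma card_image_grid_le:
  "card ((\<lambda>j. x (grid n j)) ` {..m}) \<le> Suc (card (nonzeros (grid_increment x n) m))"
proof (induction m)
  case (Suc m)
  have *: "(\<lambda>j. x (grid n j)) ` {..Suc m} = insert (x (grid n (Suc m))) ((\<lambda>j. x (grid n j)) ` {..m})"
    by (auto simp: atMost_Suc)
  show ?case
  proof (cases "grid_increment x n m = 0")
    case True
    then have "x (grid n (Suc m)) = x (grid n m)"
      by (simp add: grid_increment_def)
    then have "x (grid n (Suc m)) \<in> (\<lambda>j. x (grid n j)) ` {..m}"
      by auto
    then show ?thesis
      using Suc * True by (simp add: card_nonzeros_Suc insert_absorb)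
  next
    case False
    then show ?thesis
      using Suc * by (simp add: card_nonzeros_Suc card_insert_if)
  qed
qed simp

lemma nonzeros_card_eq_sum:
  "real (card (nonzeros \<xi> m)) = (\<Sum>j<m. indicator (- {0}) (\<xi> j))"
  by (induction m) (auto simp: card_nonzeros_Suc nonzeros_def[of \<xi> 0])

section \<open>Nondecreasing paths with locally finite range\<close>

locale rc_path =
  fixes x :: "real \<Rightarrow> real"
  assumes start: "x 0 = 0"
    and mono: "\<And>s t. 0 \<le> s \<Longrightarrow> s \<le> t \<Longrightarrow> x s \<le> x t"
    and right_cont: "\<And>t. 0 \<le> t \<Longrightarrow> continuous (at_right t) x"
begin

lemma tendsto_grid_cells:
  assumes "0 \<le> t"
  shows "(\<lambda>n. x (grid n (cells n t))) \<longlonglongrightarrow> x t"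
proof -
  have "continuous (at t within {t..}) x"
    using right_cont[OF assms] by (simp add: at_within_Ici_at_right)
  then show ?thesis
    by (rule continuous_within_tendsto_compose'[OF _ _ grid_cells_tendsto[OF assms]]) (use grid_cells[OF assms] in auto)
qed

text \<open>
  Infinitely many values on \<open>{0..t}\<close> contain \<open>K + 2\<close> distinct ones, which by right-continuity stay
  distinct when each time is moved to the next point of a fine grid. So all fine grids would see
  more than \<open>K\<close> nonzero increments.
\<close>

lemma finite_values_of_grid_bound:
  assumes "\<And>n0. \<exists>n\<ge>n0. card (nonzeros (grid_increment x n) (cells n t)) \<le> K" "0 \<le> t"
  shows "finite (x ` {0..t})"
proof (rule ccontr)
  assume "infinite (x ` {0..t})"
  then obtain V where V: "V \<subseteq> x ` {0..t}" "finite V" "card V = K + 2"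
    by (meson infinite_arbitrarily_large)
  then obtain A where A: "A \<subseteq> {0..t}" "V = x ` A" "inj_on x A"
    by (meson subset_image_inj)
  then have fin: "finite A" and cA: "card A = K + 2"
    using V by (auto simp: finite_image_iff card_image)
  define y where "y n s = x (grid n (cells n s))" for n s
  have y: "(\<lambda>n. y n s) \<longlonglongrightarrow> x s" if "s \<in> A" for s
    using that A tendsto_grid_cells unfolding y_def by auto
  have ne: "eventually (\<lambda>n. y n s \<noteq> y n u) sequentially" if "s \<in> A" "u \<in> A" "s \<noteq> u" for s u
  proof -
    have "x s - x u \<noteq> 0" using that A by (auto dest: inj_onD)
    then have "eventually (\<lambda>n. y n s - y n u \<noteq> 0) sequentially"
      by (intro tendsto_imp_eventually_ne[OF tendsto_diff[OF y y]]) (use that in auto)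
    then show ?thesis by simp
  qed
  have "eventually (\<lambda>n. \<forall>s\<in>A. \<forall>u\<in>A. s \<noteq> u \<longrightarrow> y n s \<noteq> y n u) sequentially"
    using fin ne by (auto simp: eventually_ball_finite_distrib)
  then obtain n0 where n0: "\<And>n s u. n0 \<le> n \<Longrightarrow> s \<in> A \<Longrightarrow> u \<in> A \<Longrightarrow> s \<noteq> u \<Longrightarrow> y n s \<noteq> y n u"
    unfolding eventually_sequentially by blast
  obtain n where n: "n0 \<le> n" "card (nonzeros (grid_increment x n) (cells n t)) \<le> K"
    using assms by blast
  have "inj_on (y n) A"
    using n0 n by (auto simp: inj_on_def)
  then have "K + 2 = card (y n ` A)"
    using cA by (simp add: card_image)
  also have "\<dots> \<le> card ((\<lambda>j. x (grid n j)) ` {..cells n t})"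
  proof (rule card_mono)
    show "y n ` A \<subseteq> (\<lambda>j. x (grid n j)) ` {..cells n t}"
      unfolding y_def using A by (auto intro!: imageI cells_mono)
  qed simp
  also have "\<dots> \<le> Suc K"
    using card_image_grid_le[of x n "cells n t"] n by simp
  finally show False by simp
qed

end

text \<open>
  The number of jumps up to time \<open>t\<close>, read off from the range of the path: for a nondecreasing step
  function every value below \<open>x t\<close> has been left by exactly one jump. This avoids jump times, whose
  measurability would need an argument of its own.
\<close>

definition jump_count :: "(real \<Rightarrow> real) \<Rightarrow> real \<Rightarrow> nat" where
  "jump_count x t = card {v \<in> x ` {0..}. v < x t}"

text \<open>
  The value of the path after \<open>k\<close> jumps. The choice of the time is immaterial, by
  \<open>level_jump_count\<close> below.
\<close>

definition level :: "(real \<Rightarrow> real) \<Rightarrow> nat \<Rightarrow> real" where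
  "level x k = x (SOME t. 0 \<le> t \<and> jump_count x t = k)"

definition jump_size :: "(real \<Rightarrow> real) \<Rightarrow> nat \<Rightarrow> real" where
  "jump_size x k = level x k - level x (k - 1)"

locale step_path = rc_path +
  assumes finite_values: "\<And>t. 0 \<le> t \<Longrightarrow> finite (x ` {0..t})"
    and infinite_values: "infinite (x ` {0..})"
begin

lemma finite_below:
  assumes "0 \<le> t"
  shows "finite {v \<in> x ` {0..}. v < x t}"
proof (rule finite_subset)
  show "{v \<in> x ` {0..}. v < x t} \<subseteq> x ` {0..t}"
  proof
    fix v assume "v \<in> {v \<in> x ` {0..}. v < x t}"
    then obtain s where "0 \<le> s" "v = x s" "x s < x t" by auto
    moreover from this have "s \<le> t" using mono[of t s] assms by linarith
    ultimately show "v \<in> x ` {0..t}" by auto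
  qed
qed (rule finite_values[OF assms])

lemma jump_count_strict: "0 \<le> s \<Longrightarrow> 0 \<le> t \<Longrightarrow> x s < x t \<Longrightarrow> jump_count x s < jump_count x t"
  unfolding jump_count_def by (rule psubset_card_mono[OF finite_below]) auto

lemma jump_count_cong: "x s = x t \<Longrightarrow> jump_count x s = jump_count x t"
  by (simp add: jump_count_def)

lemma jump_count_mono: "0 \<le> s \<Longrightarrow> s \<le> t \<Longrightarrow> jump_count x s \<le> jump_count x t"
  using mono[of s t] jump_count_strict[of s t] jump_count_cong[of s t] by fastforce

lemma jump_count_eq_iff:
  "0 \<le> s \<Longrightarrow> 0 \<le> t \<Longrightarrow> jump_count x s = jump_count x t \<longleftrightarrow> x s = x t"
  using jump_count_strict[of s t] jump_count_strict[of t s] jump_count_cong[of s t]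
  by (cases "x s" "x t" rule: linorder_cases) auto

lemma jump_count_0 [simp]: "jump_count x 0 = 0"
proof -
  have "{v \<in> x ` {0..}. v < x 0} = {}" using mono[of 0] by force
  then show ?thesis unfolding jump_count_def by (simp only: card.empty)
qed

text \<open>
  The jump count skips no number, since the value that follows \<open>x t\<close> in the range is attained and
  has exactly one more value below it.
\<close>

lemma jump_count_surj: "\<exists>t\<ge>0. jump_count x t = k"
proof (induction k)
  case 0
  then show ?case by (intro exI[of _ 0]) simp
next
  case (Suc k)
  then obtain t where t: "0 \<le> t" "jump_count x t = k" by auto
  have "\<not> x ` {0..} \<subseteq> x ` {0..t}"
    using infinite_values finite_values[OF t(1)] finite_subset by blast
  then obtain s where s: "0 \<le> s" "x s \<notin> x ` {0..t}" by auto
  then have ts: "t < s" by (meson atLeastAtMost_iff image_eqI not_le)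
  have "x t \<in> x ` {0..t}" using t by auto
  then have xts: "x t < x s" using mono[of t s] t ts s by (cases "x t = x s") auto
  define V where "V = {v \<in> x ` {0..s}. x t < v}"
  have V: "finite V" "V \<noteq> {}"
    using finite_values[of s] s xts by (auto simp: V_def)
  then have "Min V \<in> V" by (rule Min_in)
  then obtain u where u: "0 \<le> u" "u \<le> s" "x u = Min V" "x t < x u" by (auto simp: V_def)
  have "{v \<in> x ` {0..}. v < x u} = insert (x t) {v \<in> x ` {0..}. v < x t}"
  proof (intro equalityI subsetI)
    fix v assume "v \<in> {v \<in> x ` {0..}. v < x u}"
    then obtain r where r: "0 \<le> r" "v = x r" "x r < x u" by auto
    have "r \<le> s" using mono[of s r] mono[of u s] r u s by linarith
    then have "x r \<notin> V" using r u V by (metis Min_le not_le)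
    then have "x r \<le> x t" using r \<open>r \<le> s\<close> by (auto simp: V_def)
    then show "v \<in> insert (x t) {v \<in> x ` {0..}. v < x t}" using r by auto
  qed (use u t in auto)
  then have "jump_count x u = Suc k"
    using finite_below[OF t(1)] t by (simp add: jump_count_def)
  with u show ?case by blast
qed

lemma level_jump_count [simp]:
  assumes "0 \<le> t"
  shows "level x (jump_count x t) = x t"
proof -
  let ?s = "SOME s. 0 \<le> s \<and> jump_count x s = jump_count x t"
  have "0 \<le> ?s \<and> jump_count x ?s = jump_count x t"
    by (rule someI[of _ t]) (use assms in simp)
  then have "x ?s = x t" using jump_count_eq_iff[of ?s t] assms by auto
  then show ?thesis by (simp add: level_def)
qed

lemma sum_jump_size:
  assumes "0 \<le> t"
  shows "(\<Sum>k = 1..jump_count x t. jump_size x k) = x t"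
proof -
  have "(\<Sum>k = 1..m. jump_size x k) = level x m - level x 0" for m
    by (induction m) (auto simp: jump_size_def)
  moreover have "level x 0 = 0" using level_jump_count[of 0] start by simp
  ultimately show ?thesis using assms by simp
qed

lemma level_strict:
  assumes "j < k" shows "level x j < level x k"
proof -
  obtain s t where st: "0 \<le> s" "jump_count x s = j" "0 \<le> t" "jump_count x t = k"
    using jump_count_surj by metis
  then have "\<not> t \<le> s" using jump_count_mono[of t s] assms by auto
  then have "x s \<le> x t" using st mono[of s t] by auto
  moreover have "x s \<noteq> x t" using st assms jump_count_cong[of s t] by auto
  ultimately show ?thesis using st level_jump_count by force
qed

lemma jump_size_pos: "1 \<le> k \<Longrightarrow> 0 < jump_size x k"
  by (simp add: jump_size_def level_strict)

text \<open>
  Only finitely many values are available near \<open>t\<close>, so the next value above \<open>x t\<close> is bounded away,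
  and right-continuity keeps the path below it for some time.
\<close>

lemma locally_constant:
  assumes "0 \<le> t"
  shows "\<exists>d>0. \<forall>s. t \<le> s \<and> s < t + d \<longrightarrow> x s = x t"
proof -
  define V where "V = {v \<in> x ` {0..t+1}. x t < v}"
  have V: "finite V" using finite_values[of "t+1"] assms by (auto simp: V_def)
  have "eventually (\<lambda>s. x s < e) (at_right t)" if "x t < e" for e
    using right_cont[OF assms] that unfolding continuous_within by (rule order_tendstoD(2))
  then have "eventually (\<lambda>s. \<forall>v\<in>V. x s < v) (at_right t)"
    by (subst eventually_ball_finite_distrib[OF V]) (auto simp: V_def)
  then obtain b where b: "t < b" "\<And>s. t < s \<Longrightarrow> s < b \<Longrightarrow> \<forall>v\<in>V. x s < v"
    unfolding eventually_at_right_field by blast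
  show ?thesis
  proof (intro exI[of _ "min 1 (b - t)"] conjI allI impI)
    fix s assume s: "t \<le> s \<and> s < t + min 1 (b - t)"
    show "x s = x t"
    proof (cases "s = t")
      case False
      then have "t < s" "s < b" using s by (auto simp: min_def split: if_splits)
      then have "x s \<notin> V" using b(2)[of s] by auto
      moreover have "x s \<in> x ` {0..t+1}" using s assms by auto
      ultimately have "x s \<le> x t" by (auto simp: V_def)
      then show ?thesis using mono[of t s] assms s by auto
    qed simp
  qed (use b in simp)
qed

text \<open>
  Every count \<open>k\<close> persists for some time \<open>d k\<close> after it has been reached. If the count rose by two or
  more over a time shorter than all these \<open>d k\<close>, it would still have to be at the intermediate
  number at the end.
\<close>

lemma no_double_jumps:
  assumes "0 \<le> T"
  shows "\<exists>d>0. \<forall>a b. 0 \<le> a \<and> a \<le> b \<and> b < a + d \<and> b \<le> T \<longrightarrow> jump_count x b \<le> Suc (jump_count x a)"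
proof -
  have "\<exists>t d. 0 \<le> t \<and> 0 < d \<and> jump_count x t = k \<and> (\<forall>s. t \<le> s \<and> s < t + d \<longrightarrow> jump_count x s = k)" for k
  proof -
    obtain t where "0 \<le> t" "jump_count x t = k" using jump_count_surj by blast
    with locally_constant[of t] show ?thesis using jump_count_cong by metis
  qed
  then obtain t d where td: "\<And>k. 0 \<le> t k" "\<And>k. 0 < d k" "\<And>k. jump_count x (t k) = k"
    "\<And>k s. t k \<le> s \<Longrightarrow> s < t k + d k \<Longrightarrow> jump_count x s = k"
    by metis
  let ?D = "d ` {..jump_count x T}"
  have D: "Min ?D \<le> d k" if "k \<le> jump_count x T" for k
    using that by (intro Min_le) auto
  show ?thesis
  proof (intro exI[of _ "Min ?D"] conjI allI impI)
    show "0 < Min ?D" using td by simp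
    fix a b assume ab: "0 \<le> a \<and> a \<le> b \<and> b < a + Min ?D \<and> b \<le> T"
    show "jump_count x b \<le> Suc (jump_count x a)"
    proof (rule ccontr)
      assume nle: "\<not> ?thesis"
      define k where "k = Suc (jump_count x a)"
      have kT: "k \<le> jump_count x T"
        using nle jump_count_mono[of b T] ab by (simp add: k_def)
      have "a < t k"
        using jump_count_mono[of "t k" a] td(1,3)[of k] by (force simp: k_def)
      moreover have "t k \<le> b"
        using jump_count_mono[of b "t k"] td(1,3)[of k] nle ab by (force simp: k_def)
      moreover have "b < t k + d k" using calculation D[OF kT] ab by linarith
      ultimately have "jump_count x b = k" using td(4)[of k b] by auto
      then show False using nle by (simp add: k_def)
    qed
  qed
qed

text \<open>
  On a grid that is finer than the spacing of the jumps up to \<open>t + 1\<close>, every cell holds at most one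
  jump, so the grid sees each jump with its exact size and in the right order. The last cell may
  reach beyond \<open>t\<close>, but for a fine grid it ends before the path moves again.
\<close>

lemma grid_jumps:
  assumes t: "0 \<le> t"
  shows "eventually (\<lambda>n. card (nonzeros (grid_increment x n) (cells n t)) = jump_count x t \<and>
    (\<forall>j\<in>nonzeros (grid_increment x n) (cells n t).
       grid_increment x n j = jump_size x (rank_in (nonzeros (grid_increment x n) (cells n t)) j))) sequentially"
proof -
  \<comment> \<open>Cells may end after \<open>t\<close>, but not after \<open>t + 1\<close>, as the mesh is at most 1.\<close>
  obtain d where d: "0 < d" "\<And>a b. 0 \<le> a \<Longrightarrow> a \<le> b \<Longrightarrow> b < a + d \<Longrightarrow> b \<le> t + 1 \<Longrightarrow>
      jump_count x b \<le> Suc (jump_count x a)"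
    using no_double_jumps[of "t + 1"] t by auto
  obtain e where e: "0 < e" "\<And>s. t \<le> s \<Longrightarrow> s < t + e \<Longrightarrow> x s = x t"
    using locally_constant[OF t] by auto
  have "eventually (\<lambda>n. 1 / real (Suc n) < min d e) sequentially"
    using d e by (intro order_tendstoD(2)[OF LIMSEQ_mesh]) auto
  then show ?thesis
  proof eventually_elim
    case (elim n)
    let ?\<xi> = "grid_increment x n" and ?M = "cells n t"
    have M: "grid n ?M \<le> t + 1"
      using grid_cells[OF t, of n] grid_le_1[of n] by linarith
    have step: "jump_count x (grid n (Suc j)) = jump_count x (grid n j) + (if ?\<xi> j \<noteq> 0 then 1 else 0)"
      if "j < ?M" for j
    proof (cases "?\<xi> j = 0")
      case True
      then show ?thesis by (auto simp: grid_increment_def intro: jump_count_cong)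
    next
      case False
      have "grid n j \<le> grid n (Suc j)" by (rule grid_mono) simp
      then have "x (grid n j) < x (grid n (Suc j))"
        using False mono[of "grid n j" "grid n (Suc j)"] by (auto simp: grid_increment_def)
      then have "jump_count x (grid n j) < jump_count x (grid n (Suc j))"
        by (intro jump_count_strict) auto
      moreover have "jump_count x (grid n (Suc j)) \<le> Suc (jump_count x (grid n j))"
        using elim grid_mono[of "Suc j" ?M n] that M by (intro d(2)) (auto simp: grid_Suc)
      ultimately show ?thesis using False by simp
    qed
    have count: "jump_count x (grid n m) = card (nonzeros ?\<xi> m)" if "m \<le> ?M" for m
      using that
    proof (induction m)
      case 0
      then show ?case by (simp add: nonzeros_def)
    next
      case (Suc m)
      then show ?case using step[of m] by (simp add: card_nonzeros_Suc)
    qed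
    have "x (grid n ?M) = x t"
      using grid_cells[OF t, of n] elim by (intro e(2)) auto
    then have 1: "card (nonzeros ?\<xi> ?M) = jump_count x t"
      using count[of ?M] jump_count_cong[of "grid n ?M" t] by simp
    have 2: "?\<xi> j = jump_size x (rank_in (nonzeros ?\<xi> ?M) j)" if j: "j \<in> nonzeros ?\<xi> ?M" for j
    proof -
      have jM: "j < ?M" "?\<xi> j \<noteq> 0" using j by (auto simp: nonzeros_def)
      have "rank_in (nonzeros ?\<xi> ?M) j = jump_count x (grid n (Suc j))"
        using rank_nonzeros[OF j] count[of "Suc j"] jM by simp
      moreover have "jump_count x (grid n (Suc j)) - 1 = jump_count x (grid n j)"
        using step jM by simp
      ultimately show ?thesis
        by (simp add: jump_size_def grid_increment_def del: One_nat_def)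
    qed
    show ?case using 1 2 by blast
  qed
qed

text \<open>
  The count is bounded by its value at \<open>t\<close>, so it attains a largest value before \<open>t\<close> and keeps it.
\<close>

lemma jump_count_left_limit:
  assumes t: "0 < t"
  shows "\<exists>s0\<ge>0. s0 < t \<and> (\<forall>s. s0 \<le> s \<and> s < t \<longrightarrow> jump_count x s = jump_count x s0)"
proof -
  let ?V = "jump_count x ` {0..<t}"
  have "?V \<subseteq> {..jump_count x t}" by (auto intro: jump_count_mono)
  then have V: "finite ?V" by (rule finite_subset) simp
  then have "Max ?V \<in> ?V" using t by (intro Max_in) auto
  then obtain s0 where s0: "0 \<le> s0" "s0 < t" "jump_count x s0 = Max ?V" by auto
  have "jump_count x s = jump_count x s0" if s: "s0 \<le> s" "s < t" for s
  proof (rule antisym)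
    show "jump_count x s \<le> jump_count x s0"
      unfolding s0(3) using V s s0(1) by (intro Max_ge) auto
    show "jump_count x s0 \<le> jump_count x s"
      using s s0(1) by (intro jump_count_mono)
  qed
  with s0 show ?thesis by blast
qed

end

section \<open>First passage, sojourn and last exit between consecutive integers\<close>

lemma exp_ennreal_ennreal: "0 \<le> y \<Longrightarrow> exp_ennreal (ennreal y) = ennreal (exp y)"
  by (simp add: exp_ennreal_def)

lemma exp_ennreal_mono: "y \<le> z \<Longrightarrow> exp_ennreal y \<le> exp_ennreal z"
  by (auto simp: exp_ennreal_def top_unique less_top[symmetric] intro!: ennreal_leI enn2real_mono)

text \<open>
  All that the moments need to know about the three functionals. Comparing with the path at integer
  times treats them at once, and yields bounds that are measurable functions of the path.
\<close>

definition brackets :: "(real \<Rightarrow> real) \<Rightarrow> real \<Rightarrow> ennreal \<Rightarrow> bool" where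
  "brackets x r \<tau> \<longleftrightarrow> (\<forall>m::nat. (r < x (real m) \<longrightarrow> \<tau> \<le> ennreal (real m)) \<and>
                               (x (real m) \<le> r \<longrightarrow> ennreal (real m) \<le> \<tau>))"

lemma brackets_functionals:
  assumes mono: "\<And>s t. 0 \<le> s \<Longrightarrow> s \<le> t \<Longrightarrow> X s \<omega> \<le> X t \<omega>"
  shows "brackets (\<lambda>t. X t \<omega>) r (first_passage_time X r \<omega>)"
    and "brackets (\<lambda>t. X t \<omega>) r (sojourn_time X r \<omega>)"
    and "brackets (\<lambda>t. X t \<omega>) r (last_exit_time X r \<omega>)"
proof -
  have above: "t < real m" if "r < X (real m) \<omega>" "0 \<le> t" "X t \<omega> \<le> r" for t and m :: nat
    using mono[of "real m" t] that by force
  have below: "real m < t" if "X (real m) \<omega> \<le> r" "0 \<le> t" "r < X t \<omega>" for t and m :: nat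
    using mono[of t "real m"] that by force
  have below': "X t \<omega> \<le> r" if "X (real m) \<omega> \<le> r" "0 \<le> t" "t \<le> real m" for t and m :: nat
    using mono[of t "real m"] that by force
  show "brackets (\<lambda>t. X t \<omega>) r (first_passage_time X r \<omega>)"
    unfolding brackets_def first_passage_time_def
    by (auto intro!: Inf_lower Inf_greatest ennreal_leI less_imp_le[OF below])
  show "brackets (\<lambda>t. X t \<omega>) r (last_exit_time X r \<omega>)"
    unfolding brackets_def last_exit_time_def
    by (auto intro!: Sup_upper Sup_least ennreal_leI less_imp_le[OF above]) (metis of_nat_0_le_iff)
  have "sojourn_time X r \<omega> \<le> ennreal (real m)" if "r < X (real m) \<omega>" for m :: nat
  proof -
    have "sojourn_time X r \<omega> \<le> (\<integral>\<^sup>+t. indicator {0..real m} t \<partial>lborel)"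
      unfolding sojourn_time_def
      by (intro nn_integral_mono) (auto simp: that less_imp_le[OF above] split: split_indicator)
    then show ?thesis by simp
  qed
  moreover have "ennreal (real m) \<le> sojourn_time X r \<omega>" if "X (real m) \<omega> \<le> r" for m :: nat
  proof -
    have "(\<integral>\<^sup>+t. indicator {0..real m} t \<partial>lborel) \<le> sojourn_time X r \<omega>"
      unfolding sojourn_time_def
      by (intro nn_integral_mono) (auto simp: below'[OF that] split: split_indicator)
    then show ?thesis by simp
  qed
  ultimately show "brackets (\<lambda>t. X t \<omega>) r (sojourn_time X r \<omega>)"
    by (simp add: brackets_def)
qed

text \<open>
  If \<open>k + 1\<close> is the first integer time at which the path exceeds \<open>r\<close>, the \<open>k\<close>-th term of the series
  already dominates. If there is none, every term is at least 1 and the series diverges.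
\<close>

lemma exp_ennreal_le_of_brackets:
  assumes br: "brackets x r \<tau>" and a: "0 < a" and x0: "x 0 \<le> r"
  shows "exp_ennreal (ennreal a * \<tau>) \<le> (\<Sum>n. ennreal (exp (a * real (Suc n))) * indicator {..r} (x (real n)))"
    (is "_ \<le> suminf ?f")
proof (cases "\<exists>m::nat. r < x (real m)")
  case True
  define m where "m = (LEAST m::nat. r < x (real m))"
  have m: "r < x (real m)" unfolding m_def using True by (rule LeastI_ex)
  then obtain k where k: "m = Suc k" using x0 by (cases m) auto
  have xk: "x (real k) \<le> r" using not_less_Least[of k "\<lambda>m. r < x (real m)"] k m_def by simp
  have "\<tau> \<le> ennreal (real m)" using br m by (auto simp: brackets_def)
  then have "exp_ennreal (ennreal a * \<tau>) \<le> exp_ennreal (ennreal a * ennreal (real m))"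
    by (intro exp_ennreal_mono mult_left_mono) auto
  also have "\<dots> = ?f k"
    using a xk k by (simp add: ennreal_mult[symmetric] exp_ennreal_ennreal del: of_nat_Suc)
  also have "\<dots> = sum ?f {k}" by (simp only: sum.insert sum.empty finite.emptyI empty_iff not_False_eq_True add_0_right)
  also have "\<dots> \<le> suminf ?f" by (rule sum_le_suminf) auto
  finally show ?thesis .
next
  case False
  then have f: "1 \<le> ?f n" for n
  proof -
    have "ennreal 1 \<le> ennreal (exp (a * real (Suc n)))"
      using a by (intro ennreal_leI) simp
    then show ?thesis using False by (simp add: not_less del: of_nat_Suc)
  qed
  have "of_nat k \<le> suminf ?f" for k
  proof -
    have "of_nat k \<le> sum ?f {..<k}"
      using sum_mono[of "{..<k}" "\<lambda>_. 1" ?f] f by simp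
    also have "\<dots> \<le> suminf ?f" by (rule sum_le_suminf) auto
    finally show ?thesis .
  qed
  then have "suminf ?f = \<top>"
    using ennreal_Ex_less_of_nat by (metis less_top not_le)
  then show ?thesis by simp
qed

text \<open>
  The coefficients \<open>(exp a - 1) * exp (a n) = exp (a (n+1)) - exp (a n)\<close> telescope. By
  monotonicity the indices with \<open>x (n+1) \<le> r\<close> form an initial segment, so a partial sum with \<open>m\<close> of
  them is \<open>exp (a m) - 1\<close>, where \<open>x m \<le> r\<close> if \<open>m > 0\<close>.
\<close>

lemma exp_ennreal_ge_of_brackets:
  assumes br: "brackets x r \<tau>" and a: "0 < a"
    and mono: "\<And>s t. 0 \<le> s \<Longrightarrow> s \<le> t \<Longrightarrow> x s \<le> x t"
  shows "(\<Sum>n. ennreal ((exp a - 1) * exp (a * real n)) * indicator {..r} (x (real (Suc n)))) \<le> exp_ennreal (ennreal a * \<tau>)"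
    (is "suminf ?f \<le> _")
proof -
  have "sum ?f {..<m} \<le> exp_ennreal (ennreal a * \<tau>)" for m
  proof (induction m)
    case (Suc m)
    show ?case
    proof (cases "x (real (Suc m)) \<le> r")
      case True
      have "x (real (Suc n)) \<le> r" if "n < Suc m" for n
        using mono[of "real (Suc n)" "real (Suc m)"] True that by simp
      then have "sum ?f {..<Suc m} = (\<Sum>n<Suc m. ennreal ((exp a - 1) * exp (a * real n)))"
        by (intro sum.cong refl) (simp del: of_nat_Suc)
      also have "\<dots> = ennreal (\<Sum>n<Suc m. (exp a - 1) * exp (a * real n))"
        using a by (intro sum_ennreal) auto
      also have "(\<Sum>n<Suc m. (exp a - 1) * exp (a * real n)) = (\<Sum>n<Suc m. exp (a * real (Suc n)) - exp (a * real n))"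
        by (intro sum.cong refl) (simp add: algebra_simps exp_add)
      also have "\<dots> = exp (a * real (Suc m)) - 1"
        by (subst sum_lessThan_telescope) simp
      also have "ennreal \<dots> \<le> exp_ennreal (ennreal a * ennreal (real (Suc m)))"
        using a by (simp add: ennreal_mult[symmetric] exp_ennreal_ennreal ennreal_leI del: of_nat_Suc)
      also have "\<dots> \<le> exp_ennreal (ennreal a * \<tau>)"
        using br True by (intro exp_ennreal_mono mult_left_mono) (auto simp: brackets_def simp del: of_nat_Suc)
      finally show ?thesis .
    next
      case False
      then show ?thesis using Suc by (simp del: of_nat_Suc)
    qed
  qed simp
  then show ?thesis unfolding suminf_eq_SUP by (rule SUP_least)
qed

section \<open>Exponential moments and the atom of a subordinator at zero\<close>

lemma suminf_power_less_top:
  fixes q :: ennreal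
  assumes "q < 1"
  shows "(\<Sum>n. q ^ n) < \<top>"
proof -
  obtain y where y: "q = ennreal y" "0 \<le> y" "y < 1"
    using assms by (cases q) (auto simp: ennreal_1[symmetric] ennreal_less_iff simp del: ennreal_1)
  then have "(\<Sum>n. q ^ n) = ennreal (\<Sum>n. y ^ n)"
    by (simp add: ennreal_power suminf_ennreal2)
  then show ?thesis by simp
qed

context subordinator
begin

lemma measurable_X [measurable]: "0 \<le> t \<Longrightarrow> X t \<in> borel_measurable M"
  by (rule random_variables)

lemma AE_nonneg: "AE \<omega> in M. \<forall>t\<ge>0. 0 \<le> X t \<omega>"
  using nondecreasing AE_space by eventually_elim (metis start_zero order_refl)

lemma AE_brackets:
  assumes "\<tau> \<in> {first_passage_time X, sojourn_time X, last_exit_time X}"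
  shows "AE \<omega> in M. brackets (\<lambda>t. X t \<omega>) r (\<tau> r \<omega>)"
  using nondecreasing by eventually_elim (use assms brackets_functionals[of X] in auto)

definition laplace :: "real \<Rightarrow> ennreal" where
  "laplace s = (\<integral>\<^sup>+\<omega>. ennreal (exp (- s * X 1 \<omega>)) \<partial>M)"

text \<open>
  \<open>X n\<close> is the sum of its \<open>n\<close> increments over unit intervals, which are independent copies of \<open>X 1\<close>.
\<close>

lemma laplace_power: "(\<integral>\<^sup>+\<omega>. ennreal (exp (- s * X (real n) \<omega>)) \<partial>M) = laplace s ^ n"
proof -
  let ?D = "\<lambda>i \<omega>. X (real (Suc i)) \<omega> - X (real i) \<omega>"
  have ind: "indep_vars (\<lambda>_. borel) ?D {..<n}"
    by (rule independent_increments) auto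
  have "indep_vars (\<lambda>_. borel) (\<lambda>i \<omega>. ennreal (exp (- s * ?D i \<omega>))) {..<n}"
    by (rule indep_vars_compose2[OF ind, where Y = "\<lambda>_ v. ennreal (exp (- s * v))"]) measurable
  then have *: "(\<integral>\<^sup>+\<omega>. (\<Prod>i<n. ennreal (exp (- s * ?D i \<omega>))) \<partial>M) = (\<Prod>i<n. \<integral>\<^sup>+\<omega>. ennreal (exp (- s * ?D i \<omega>)) \<partial>M)"
    by (intro indep_vars_nn_integral) auto
  have "(\<Prod>i<n. ennreal (exp (- s * ?D i \<omega>))) = ennreal (exp (- s * X (real n) \<omega>))" if "\<omega> \<in> space M" for \<omega>
  proof -
    have "(\<Prod>i<n. ennreal (exp (- s * ?D i \<omega>))) = ennreal (\<Prod>i<n. exp (- s * ?D i \<omega>))"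
      by (rule prod_ennreal) simp
    also have "(\<Prod>i<n. exp (- s * ?D i \<omega>)) = exp (- s * (\<Sum>i<n. ?D i \<omega>))"
      by (simp add: exp_sum[symmetric] sum_distrib_left)
    also have "(\<Sum>i<n. ?D i \<omega>) = X (real n) \<omega>"
      using that by (subst sum_lessThan_telescope) (simp add: start_zero)
    finally show ?thesis .
  qed
  then have "(\<integral>\<^sup>+\<omega>. ennreal (exp (- s * X (real n) \<omega>)) \<partial>M) = (\<integral>\<^sup>+\<omega>. (\<Prod>i<n. ennreal (exp (- s * ?D i \<omega>))) \<partial>M)"
    by (intro nn_integral_cong) simp
  also have "\<dots> = (\<Prod>i<n. laplace s)"
    unfolding *
  proof (intro prod.cong refl)
    fix i
    have "(\<integral>\<^sup>+\<omega>. ennreal (exp (- s * ?D i \<omega>)) \<partial>M)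
        = (\<integral>\<^sup>+v. ennreal (exp (- s * v)) \<partial>distr M borel (?D i))"
      by (subst nn_integral_distr) auto
    also have "distr M borel (?D i) = distr M borel (X 1)"
      using stationary_increments[of "real i" "real (Suc i)"] by simp
    also have "(\<integral>\<^sup>+v. ennreal (exp (- s * v)) \<partial>distr M borel (X 1)) = laplace s"
      unfolding laplace_def by (subst nn_integral_distr) auto
    finally show "(\<integral>\<^sup>+\<omega>. ennreal (exp (- s * ?D i \<omega>)) \<partial>M) = laplace s" .
  qed
  finally show ?thesis by simp
qed

lemma chernoff_bound:
  assumes "0 \<le> s"
  shows "emeasure M {\<omega> \<in> space M. X (real n) \<omega> \<le> r} \<le> ennreal (exp (s * r)) * laplace s ^ n"
proof -
  have "emeasure M {\<omega> \<in> space M. X (real n) \<omega> \<le> r} = (\<integral>\<^sup>+\<omega>. indicator {\<omega> \<in> space M. X (real n) \<omega> \<le> r} \<omega> \<partial>M)"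
    by simp
  also have "\<dots> \<le> (\<integral>\<^sup>+\<omega>. ennreal (exp (s * r)) * ennreal (exp (- s * X (real n) \<omega>)) \<partial>M)"
  proof (intro nn_integral_mono)
    fix \<omega>
    show "indicator {\<omega> \<in> space M. X (real n) \<omega> \<le> r} \<omega> \<le> ennreal (exp (s * r)) * ennreal (exp (- s * X (real n) \<omega>))"
    proof (cases "X (real n) \<omega> \<le> r")
      case True
      then have "0 \<le> s * r + - s * X (real n) \<omega>"
        using assms mult_left_mono[of "X (real n) \<omega>" r s] by simp
      then have "1 \<le> exp (s * r) * exp (- s * X (real n) \<omega>)"
        unfolding exp_add[symmetric] by (simp only: one_le_exp_iff)
      then show ?thesis
        by (auto simp: ennreal_mult[symmetric] ennreal_1[symmetric] simp del: ennreal_1 intro!: ennreal_leI split: split_indicator)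
    qed auto
  qed
  also have "\<dots> = ennreal (exp (s * r)) * laplace s ^ n"
    unfolding laplace_power[symmetric] by (rule nn_integral_cmult) measurable
  finally show ?thesis .
qed

text \<open>
  For \<open>X 1 \<ge> 0\<close> the functions \<open>exp (- k X 1)\<close> decrease to the indicator of \<open>X 1 = 0\<close>.
\<close>

lemma laplace_tendsto: "(\<lambda>k. laplace (real k)) \<longlonglongrightarrow> emeasure M {\<omega> \<in> space M. X 1 \<omega> = 0}"
proof -
  have "(\<lambda>k. \<integral>\<^sup>+\<omega>. ennreal (exp (- real k * X 1 \<omega>)) \<partial>M)
      \<longlonglongrightarrow> (\<integral>\<^sup>+\<omega>. indicator {\<omega> \<in> space M. X 1 \<omega> = 0} \<omega> \<partial>M)"
  proof (rule nn_integral_dominated_convergence[where w = "\<lambda>_. 1"])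
    show "AE \<omega> in M. ennreal (exp (- real k * X 1 \<omega>)) \<le> 1" for k
      using AE_nonneg by eventually_elim (auto simp: ennreal_1[symmetric] simp del: ennreal_1 intro!: ennreal_leI)
    show "AE \<omega> in M. (\<lambda>k. ennreal (exp (- real k * X 1 \<omega>))) \<longlonglongrightarrow> indicator {\<omega> \<in> space M. X 1 \<omega> = 0} \<omega>"
      using AE_nonneg AE_space
    proof eventually_elim
      case (elim \<omega>)
      show ?case
      proof (cases "X 1 \<omega> = 0")
        case False
        then have "0 < X 1 \<omega>" using elim by (metis less_le zero_le_one)
        then have "(\<lambda>k. exp (- X 1 \<omega>) ^ k) \<longlonglongrightarrow> 0"
          by (intro LIMSEQ_realpow_zero) auto
        then have "(\<lambda>k. exp (- real k * X 1 \<omega>)) \<longlonglongrightarrow> 0"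
          by (simp add: exp_of_nat_mult[symmetric])
        then have "(\<lambda>k. ennreal (exp (- real k * X 1 \<omega>))) \<longlonglongrightarrow> ennreal 0"
          by (rule tendsto_ennrealI)
        then show ?thesis using False by simp
      qed (use elim in simp)
    qed
  qed (auto simp: emeasure_space_1)
  then show ?thesis by (simp add: laplace_def)
qed

lemma exp_moment_finite:
  assumes \<tau>: "\<tau> \<in> {first_passage_time X, sojourn_time X, last_exit_time X}"
    and a: "0 < a" and r: "0 \<le> r"
    and less: "ennreal (exp a) * emeasure M {\<omega> \<in> space M. X 1 \<omega> = 0} < 1"
  shows "exp_moment M a (\<tau> r) < \<infinity>"
proof -
  have "(\<lambda>k. ennreal (exp a) * laplace (real k)) \<longlonglongrightarrow> ennreal (exp a) * emeasure M {\<omega> \<in> space M. X 1 \<omega> = 0}"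
    by (rule ennreal_tendsto_cmult[OF _ laplace_tendsto]) simp
  from order_tendstoD(2)[OF this less] obtain k where k: "ennreal (exp a) * laplace (real k) < 1"
    using eventually_happens by force
  have "exp_moment M a (\<tau> r) \<le> (\<integral>\<^sup>+\<omega>. (\<Sum>n. ennreal (exp (a * real (Suc n))) * indicator {..r} (X (real n) \<omega>)) \<partial>M)"
    unfolding exp_moment_def
  proof (rule nn_integral_mono_AE)
    show "AE \<omega> in M. exp_ennreal (ennreal a * \<tau> r \<omega>) \<le> (\<Sum>n. ennreal (exp (a * real (Suc n))) * indicator {..r} (X (real n) \<omega>))"
      using AE_brackets[OF \<tau>, of r] AE_space
      by eventually_elim (use a r start_zero in \<open>auto intro!: exp_ennreal_le_of_brackets simp del: of_nat_Suc\<close>)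
  qed
  also have "\<dots> = (\<Sum>n. \<integral>\<^sup>+\<omega>. ennreal (exp (a * real (Suc n))) * indicator {..r} (X (real n) \<omega>) \<partial>M)"
    by (rule nn_integral_suminf) measurable
  also have "\<dots> \<le> (\<Sum>n. ennreal (exp a) * ennreal (exp (real k * r)) * (ennreal (exp a) * laplace (real k)) ^ n)"
  proof (rule suminf_le)
    fix n
    have "(\<integral>\<^sup>+\<omega>. ennreal (exp (a * real (Suc n))) * indicator {..r} (X (real n) \<omega>) \<partial>M)
       = ennreal (exp (a * real (Suc n))) * (\<integral>\<^sup>+\<omega>. indicator {..r} (X (real n) \<omega>) \<partial>M)"
      by (rule nn_integral_cmult) measurable
    also have "(\<integral>\<^sup>+\<omega>. indicator {..r} (X (real n) \<omega>) \<partial>M) = (\<integral>\<^sup>+\<omega>. indicator {\<omega> \<in> space M. X (real n) \<omega> \<le> r} \<omega> \<partial>M)"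
      by (intro nn_integral_cong) (auto split: split_indicator)
    also have "\<dots> = emeasure M {\<omega> \<in> space M. X (real n) \<omega> \<le> r}"
      by simp
    also have "ennreal (exp (a * real (Suc n))) * \<dots> \<le> ennreal (exp (a * real (Suc n))) * (ennreal (exp (real k * r)) * laplace (real k) ^ n)"
      by (intro mult_left_mono chernoff_bound) auto
    also have "\<dots> = ennreal (exp a) * ennreal (exp a) ^ n * (ennreal (exp (real k * r)) * laplace (real k) ^ n)"
      by (simp add: ennreal_mult[symmetric] ennreal_power exp_add exp_of_nat_mult[symmetric] distrib_left mult.commute)
    finally show "(\<integral>\<^sup>+\<omega>. ennreal (exp (a * real (Suc n))) * indicator {..r} (X (real n) \<omega>) \<partial>M)
      \<le> ennreal (exp a) * ennreal (exp (real k * r)) * (ennreal (exp a) * laplace (real k)) ^ n"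
      by (simp only: power_mult_distrib ac_simps)
  qed auto
  also have "\<dots> = ennreal (exp a) * ennreal (exp (real k * r)) * (\<Sum>n. (ennreal (exp a) * laplace (real k)) ^ n)"
    by (rule ennreal_suminf_cmult)
  also have "\<dots> < \<infinity>"
    using suminf_power_less_top[OF k] by (simp add: ennreal_mult_less_top)
  finally show ?thesis .
qed

text \<open>
  Some Laplace transform value is below 1, so the Chernoff bound tends to 0 for every level.
\<close>

lemma AE_unbounded:
  assumes "emeasure M {\<omega> \<in> space M. X 1 \<omega> = 0} < 1"
  shows "AE \<omega> in M. \<forall>b::nat. \<exists>n::nat. real b < X (real n) \<omega>"
proof (subst AE_all_countable, rule allI)
  fix b :: nat
  from order_tendstoD(2)[OF laplace_tendsto assms] obtain k where k: "laplace (real k) < 1"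
    using eventually_happens by force
  have lim: "(\<lambda>n. ennreal (exp (real k * real b)) * laplace (real k) ^ n) \<longlonglongrightarrow> ennreal (exp (real k * real b)) * 0"
  proof (rule ennreal_tendsto_cmult)
    obtain y where y: "laplace (real k) = ennreal y" "0 \<le> y" "y < 1"
      using k by (cases "laplace (real k)") (auto simp: ennreal_1[symmetric] ennreal_less_iff simp del: ennreal_1)
    then have "(\<lambda>n. y ^ n) \<longlonglongrightarrow> 0" by (intro LIMSEQ_realpow_zero) auto
    then have "(\<lambda>n. ennreal (y ^ n)) \<longlonglongrightarrow> ennreal 0" by (rule tendsto_ennrealI)
    then show "(\<lambda>n. laplace (real k) ^ n) \<longlonglongrightarrow> 0" using y by (simp add: ennreal_power)
  qed simp
  let ?B = "{\<omega> \<in> space M. \<forall>n::nat. X (real n) \<omega> \<le> real b}"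
  have "emeasure M ?B \<le> ennreal (exp (real k * real b)) * laplace (real k) ^ n" for n
    by (rule order_trans[OF emeasure_mono chernoff_bound]) auto
  then have "emeasure M ?B \<le> 0"
    using LIMSEQ_le_const[OF lim] by auto
  then have "?B \<in> null_sets M"
    by (intro null_setsI) auto
  then show "AE \<omega> in M. \<exists>n::nat. real b < X (real n) \<omega>"
    by (rule AE_I') (auto simp: not_less)
qed

text \<open>
  Since the jumps are positive, the compound sum vanishes only if there has been no jump.
\<close>

lemma compound_poisson_zero_prob:
  assumes "compound_poisson_process M X c" "1 \<le> n"
  shows "emeasure M {\<omega> \<in> space M. X (real n) \<omega> = 0} = ennreal (exp (- c * real n))"
proof -
  obtain N Y where "compound_poisson_representation M N c X Y"
    using assms by (auto simp: compound_poisson_process_def)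
  then interpret R: compound_poisson_representation M N c X Y .
  have N: "N (real n) \<in> measurable M (count_space UNIV)"
  proof -
    have "(\<lambda>\<omega>. nat \<lfloor>real (N (real n) \<omega>)\<rfloor>) \<in> measurable M (count_space UNIV)"
      using R.random_variables[of "real n"] by measurable
    then show ?thesis by simp
  qed
  have "AE \<omega> in M. \<forall>k. 1 \<le> k \<longrightarrow> 0 < Y k \<omega>"
    using R.jumps_positive by (auto simp: AE_all_countable)
  with R.random_sum have "AE \<omega> in M. X (real n) \<omega> = 0 \<longleftrightarrow> N (real n) \<omega> = 0"
  proof eventually_elim
    case (elim \<omega>)
    have "0 < (\<Sum>k = 1..N (real n) \<omega>. Y k \<omega>)" if "N (real n) \<omega> \<noteq> 0"
      using elim that by (intro sum_pos) auto
    then show ?case using elim by (cases "N (real n) \<omega> = 0") auto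
  qed
  then have "emeasure M {\<omega> \<in> space M. X (real n) \<omega> = 0} = emeasure M {\<omega> \<in> space M. N (real n) \<omega> = 0}"
    using N by (intro emeasure_eq_AE) auto
  also have "{\<omega> \<in> space M. N (real n) \<omega> = 0} = N (real n) -` {0} \<inter> space M" by auto
  also have "emeasure M \<dots> = emeasure (distr M (count_space UNIV) (N (real n))) {0}"
    using N by (subst emeasure_distr) auto
  also have "\<dots> = ennreal (exp (- c * real n))"
    using assms R.rate_pos by (subst R.poisson_distributed) (auto simp: emeasure_pmf_single)
  finally show ?thesis .
qed

text \<open>
  For \<open>c \<le> a\<close> the growth \<open>exp (a n)\<close> outweighs \<open>P(X (n+1) \<le> r) \<ge> exp (- c (n+1))\<close>, and the terms of the
  lower series are bounded below by a positive constant.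
\<close>

lemma exp_moment_infinite:
  assumes \<tau>: "\<tau> \<in> {first_passage_time X, sojourn_time X, last_exit_time X}"
    and a: "0 < a" and r: "0 \<le> r" and c: "c \<le> a" "compound_poisson_process M X c"
  shows "exp_moment M a (\<tau> r) = \<infinity>"
proof -
  let ?f = "\<lambda>n \<omega>. ennreal ((exp a - 1) * exp (a * real n)) * indicator {..r} (X (real (Suc n)) \<omega>)"
  define e where "e = (exp a - 1) * exp (- c)"
  have e: "0 < e" using a by (simp add: e_def)
  have "\<top> = (\<Sum>n::nat. ennreal e)"
    using e unfolding nn_integral_count_space_nat[symmetric] by (simp add: ennreal_mult_top)
  also have "\<dots> \<le> (\<Sum>n. \<integral>\<^sup>+\<omega>. ?f n \<omega> \<partial>M)"
  proof (rule suminf_le)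
    fix n
    have "e \<le> ((exp a - 1) * exp (a * real n)) * exp (- c * real (Suc n))"
    proof -
      have "exp (- c) \<le> exp (a * real n + - c * real (Suc n))"
        using c mult_right_mono[of c a "real n"] by (simp add: algebra_simps)
      then show ?thesis
        using a unfolding e_def exp_add mult.assoc by (intro mult_left_mono) auto
    qed
    then have "ennreal e \<le> ennreal ((exp a - 1) * exp (a * real n)) * ennreal (exp (- c * real (Suc n)))"
      using a by (subst ennreal_mult[symmetric]) (auto intro!: ennreal_leI simp del: of_nat_Suc)
    also have "\<dots> = ennreal ((exp a - 1) * exp (a * real n)) * emeasure M {\<omega> \<in> space M. X (real (Suc n)) \<omega> = 0}"
      using compound_poisson_zero_prob[OF c(2), of "Suc n"] by simp
    also have "\<dots> \<le> ennreal ((exp a - 1) * exp (a * real n)) * emeasure M {\<omega> \<in> space M. X (real (Suc n)) \<omega> \<le> r}"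
      using r by (intro mult_left_mono emeasure_mono) (auto simp del: of_nat_Suc)
    also have "emeasure M {\<omega> \<in> space M. X (real (Suc n)) \<omega> \<le> r} = (\<integral>\<^sup>+\<omega>. indicator {\<omega> \<in> space M. X (real (Suc n)) \<omega> \<le> r} \<omega> \<partial>M)"
      by (simp del: of_nat_Suc)
    also have "\<dots> = (\<integral>\<^sup>+\<omega>. indicator {..r} (X (real (Suc n)) \<omega>) \<partial>M)"
      by (intro nn_integral_cong) (auto split: split_indicator)
    also have "ennreal ((exp a - 1) * exp (a * real n)) * \<dots> = (\<integral>\<^sup>+\<omega>. ?f n \<omega> \<partial>M)"
      by (rule nn_integral_cmult[symmetric]) measurable
    finally show "ennreal e \<le> (\<integral>\<^sup>+\<omega>. ?f n \<omega> \<partial>M)" .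
  qed auto
  also have "\<dots> = (\<integral>\<^sup>+\<omega>. (\<Sum>n. ?f n \<omega>) \<partial>M)"
    by (rule nn_integral_suminf[symmetric]) measurable
  also have "\<dots> \<le> exp_moment M a (\<tau> r)"
    unfolding exp_moment_def
  proof (rule nn_integral_mono_AE)
    show "AE \<omega> in M. (\<Sum>n. ?f n \<omega>) \<le> exp_ennreal (ennreal a * \<tau> r \<omega>)"
      using AE_brackets[OF \<tau>, of r] nondecreasing
      by eventually_elim (rule exp_ennreal_ge_of_brackets, use a in auto)
  qed
  finally show ?thesis by (simp add: top_unique)
qed

end

section \<open>Laws of eventually constant sequences of random variables\<close>

text \<open>
  Eventual equality is stronger than convergence in law: it gives convergence of the probabilities
  of arbitrary events, by dominated convergence of indicators.
\<close>

lemma (in prob_space) prob_tendsto_of_eventually_eq: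
  assumes [measurable]: "\<And>n. {\<omega> \<in> space M. P n \<omega>} \<in> events" "{\<omega> \<in> space M. Q \<omega>} \<in> events"
    and ev: "AE \<omega> in M. eventually (\<lambda>n. P n \<omega> = Q \<omega>) sequentially"
  shows "(\<lambda>n. prob {\<omega> \<in> space M. P n \<omega>}) \<longlonglongrightarrow> prob {\<omega> \<in> space M. Q \<omega>}"
proof -
  have "(\<lambda>n. LINT \<omega>|M. indicator {\<omega> \<in> space M. P n \<omega>} \<omega> :: real)
      \<longlonglongrightarrow> (LINT \<omega>|M. indicator {\<omega> \<in> space M. Q \<omega>} \<omega>)"
  proof (rule integral_dominated_convergence[where w = "\<lambda>_. 1"])
    show "AE \<omega> in M. (\<lambda>n. indicator {\<omega> \<in> space M. P n \<omega>} \<omega> :: real) \<longlonglongrightarrow> indicator {\<omega> \<in> space M. Q \<omega>} \<omega>"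
      using ev
    proof eventually_elim
      case (elim \<omega>)
      then have "eventually (\<lambda>n. indicator {\<omega> \<in> space M. P n \<omega>} \<omega> = (indicator {\<omega> \<in> space M. Q \<omega>} \<omega> :: real)) sequentially"
        by eventually_elim (simp add: indicator_def)
      then show ?case by (rule tendsto_eventually)
    qed
  qed auto
  moreover have "{\<omega> \<in> space M. R \<omega>} \<inter> space M = {\<omega> \<in> space M. R \<omega>}" for R by auto
  ultimately show ?thesis by simp
qed

lemma (in prob_space) indep_vars_of_eventually_eq:
  fixes Z :: "'i \<Rightarrow> 'a \<Rightarrow> 'b"
  assumes ind: "\<And>n. indep_vars M' (W n) I" and I: "finite I"
    and rv: "\<And>i. i \<in> I \<Longrightarrow> random_variable (M' i) (Z i)"
    and ev: "\<And>i. i \<in> I \<Longrightarrow> AE \<omega> in M. eventually (\<lambda>n. W n i \<omega> = Z i \<omega>) sequentially"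
  shows "indep_vars M' Z I"
  unfolding indep_vars_def2 indep_sets_def
proof (intro conjI ballI allI impI)
  fix i assume "i \<in> I"
  then show "random_variable (M' i) (Z i)" by (rule rv)
  then show "{Z i -` A \<inter> space M |A. A \<in> sets (M' i)} \<subseteq> events" by auto
next
  fix J A assume J: "J \<subseteq> I" "J \<noteq> {}" "finite J" and A: "A \<in> (\<Pi> i\<in>J. {Z i -` A \<inter> space M |A. A \<in> sets (M' i)})"
  have "\<exists>B. \<forall>j\<in>J. B j \<in> sets (M' j) \<and> A j = Z j -` B j \<inter> space M"
    using A by (intro bchoice) (fastforce simp: Pi_iff)
  then obtain B where B: "\<And>j. j \<in> J \<Longrightarrow> B j \<in> sets (M' j)" "\<And>j. j \<in> J \<Longrightarrow> A j = {\<omega> \<in> space M. Z j \<omega> \<in> B j}"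
    by (auto simp: vimage_def Int_def conj_commute)
  have W: "random_variable (M' j) (W n j)" if "j \<in> J" for n j
    using ind[of n] J that by (auto simp: indep_vars_def)
  have mW: "{\<omega> \<in> space M. W n j \<omega> \<in> B j} \<in> events" if "j \<in> J" for n j
    using measurable_sets[OF W B(1), OF that that, of n] by (simp add: vimage_def Int_def conj_commute)
  have mZ: "{\<omega> \<in> space M. Z j \<omega> \<in> B j} \<in> events" if "j \<in> J" for j
    using measurable_sets[OF rv B(1), of j] J that by (auto simp: vimage_def Int_def conj_commute)
  have all: "AE \<omega> in M. \<forall>j\<in>J. eventually (\<lambda>n. W n j \<omega> = Z j \<omega>) sequentially"
    using ev J by (intro AE_finite_allI) auto
  have "(\<lambda>n. prob {\<omega> \<in> space M. \<forall>j\<in>J. W n j \<omega> \<in> B j}) \<longlonglongrightarrow> prob {\<omega> \<in> space M. \<forall>j\<in>J. Z j \<omega> \<in> B j}"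
  proof (rule prob_tendsto_of_eventually_eq)
    show "AE \<omega> in M. eventually (\<lambda>n. (\<forall>j\<in>J. W n j \<omega> \<in> B j) = (\<forall>j\<in>J. Z j \<omega> \<in> B j)) sequentially"
      using all
    proof eventually_elim
      case (elim \<omega>)
      then have "eventually (\<lambda>n. \<forall>j\<in>J. W n j \<omega> = Z j \<omega>) sequentially"
        using J by (simp add: eventually_ball_finite)
      then show ?case by eventually_elim auto
    qed
  qed (use J mW mZ in \<open>auto intro!: sets.sets_Collect_finite_All\<close>)
  moreover have "(\<lambda>n. prob {\<omega> \<in> space M. \<forall>j\<in>J. W n j \<omega> \<in> B j}) \<longlonglongrightarrow> (\<Prod>j\<in>J. prob (A j))"
  proof -
    have "prob {\<omega> \<in> space M. \<forall>j\<in>J. W n j \<omega> \<in> B j} = (\<Prod>j\<in>J. prob {\<omega> \<in> space M. W n j \<omega> \<in> B j})" for n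
    proof -
      have "{\<omega> \<in> space M. \<forall>j\<in>J. W n j \<omega> \<in> B j} = (\<Inter>j\<in>J. W n j -` B j \<inter> space M)"
        using J by auto
      then have "prob {\<omega> \<in> space M. \<forall>j\<in>J. W n j \<omega> \<in> B j} = (\<Prod>j\<in>J. prob (W n j -` B j \<inter> space M))"
        using indep_varsD[OF ind[of n] J(2,3,1) B(1)] by simp
      then show ?thesis by (simp add: vimage_def Int_def conj_commute)
    qed
    moreover have "(\<lambda>n. \<Prod>j\<in>J. prob {\<omega> \<in> space M. W n j \<omega> \<in> B j}) \<longlonglongrightarrow> (\<Prod>j\<in>J. prob {\<omega> \<in> space M. Z j \<omega> \<in> B j})"
    proof (intro tendsto_prod prob_tendsto_of_eventually_eq mW mZ)
      fix j assume "j \<in> J"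
      then have "AE \<omega> in M. eventually (\<lambda>n. W n j \<omega> = Z j \<omega>) sequentially"
        using ev J by blast
      then show "AE \<omega> in M. eventually (\<lambda>n. (W n j \<omega> \<in> B j) = (Z j \<omega> \<in> B j)) sequentially"
        by eventually_elim (auto elim!: eventually_mono)
    qed
    ultimately show ?thesis using B by simp
  qed
  ultimately have "prob {\<omega> \<in> space M. \<forall>j\<in>J. Z j \<omega> \<in> B j} = (\<Prod>j\<in>J. prob (A j))"
    by (rule LIMSEQ_unique)
  moreover have "\<Inter> (A ` J) = {\<omega> \<in> space M. \<forall>j\<in>J. Z j \<omega> \<in> B j}"
    using J B by auto
  ultimately show "prob (\<Inter> (A ` J)) = (\<Prod>j\<in>J. prob (A j))" by simp
qed

text \<open>
  The \<open>\<sigma>\<close>-algebra generated by a family of random variables is generated by the events that concern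
  finitely many of them, for which independence can be checked by product formulas.
\<close>

lemma sets_vimage_algebra_PiM:
  assumes "f \<in> \<Omega> \<rightarrow> (\<Pi>\<^sub>E i\<in>I. space (L i))"
  shows "sets (vimage_algebra \<Omega> f (PiM I L)) = sigma_sets \<Omega> {f -` A \<inter> \<Omega> | A. A \<in> prod_algebra I L}"
proof -
  have "sets (PiM I L) = sets (sigma (\<Pi>\<^sub>E i\<in>I. space (L i)) (prod_algebra I L))"
    by (simp add: sets_PiM prod_algebra_sets_into_space)
  then have "sets (vimage_algebra \<Omega> f (PiM I L)) = sets (vimage_algebra \<Omega> f (sigma (\<Pi>\<^sub>E i\<in>I. space (L i)) (prod_algebra I L)))"
    by (rule sets_vimage_algebra_cong)
  also have "\<dots> = sigma_sets \<Omega> {f -` A \<inter> \<Omega> | A. A \<in> prod_algebra I L}"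
    by (subst vimage_algebra_sigma[OF prod_algebra_sets_into_space assms]) (auto intro!: sets_measure_of)
  finally show ?thesis .
qed

lemma Int_stable_vimage:
  assumes "Int_stable \<G>"
  shows "Int_stable {f -` A \<inter> \<Omega> | A. A \<in> \<G>}"
proof (rule Int_stableI)
  fix a b assume "a \<in> {f -` A \<inter> \<Omega> | A. A \<in> \<G>}" "b \<in> {f -` A \<inter> \<Omega> | A. A \<in> \<G>}"
  then obtain A B where "a = f -` A \<inter> \<Omega>" "A \<in> \<G>" "b = f -` B \<inter> \<Omega>" "B \<in> \<G>" by auto
  then show "a \<inter> b \<in> {f -` A \<inter> \<Omega> | A. A \<in> \<G>}"
    using Int_stableD[OF assms, of A B] by (intro CollectI exI[of _ "A \<inter> B"]) auto
qed

lemma vimage_prod_algebraE: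
  assumes "a \<in> {(\<lambda>\<omega>. \<lambda>i\<in>I. Z i \<omega>) -` A \<inter> \<Omega> | A. A \<in> prod_algebra I L}"
    and "\<And>i \<omega>. i \<in> I \<Longrightarrow> \<omega> \<in> \<Omega> \<Longrightarrow> Z i \<omega> \<in> space (L i)"
  obtains J E where "finite J" "J \<subseteq> I" "\<And>i. i \<in> J \<Longrightarrow> E i \<in> sets (L i)" "a = {\<omega> \<in> \<Omega>. \<forall>i\<in>J. Z i \<omega> \<in> E i}"
proof -
  obtain A where A: "A \<in> prod_algebra I L" "a = (\<lambda>\<omega>. \<lambda>i\<in>I. Z i \<omega>) -` A \<inter> \<Omega>" using assms(1) by auto
  from A(1) show ?thesis
  proof (rule prod_algebraE)
    fix J E assume JE: "A = prod_emb I L J (Pi\<^sub>E J E)" "finite J" "J \<subseteq> I" "\<And>i. i \<in> J \<Longrightarrow> E i \<in> sets (L i)"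
    have "a = {\<omega> \<in> \<Omega>. \<forall>i\<in>J. Z i \<omega> \<in> E i}"
      unfolding A(2) JE(1) using assms(2) JE(3) by (auto simp: prod_emb_def PiE_iff subset_eq)
    with JE show ?thesis by (intro that[of J E]) auto
  qed
qed

section \<open>Independent steps with an atom at zero\<close>

lemma (in prob_space) prob_split_finite:
  assumes fin: "finite \<F>" and meas: "\<And>S. S \<in> \<F> \<Longrightarrow> {\<omega> \<in> space M. f \<omega> = S \<and> P S \<omega>} \<in> events"
  shows "prob {\<omega> \<in> space M. f \<omega> \<in> \<F> \<and> P (f \<omega>) \<omega>} = (\<Sum>S\<in>\<F>. prob {\<omega> \<in> space M. f \<omega> = S \<and> P S \<omega>})"
    and "{\<omega> \<in> space M. f \<omega> \<in> \<F> \<and> P (f \<omega>) \<omega>} \<in> events"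
proof -
  have *: "{\<omega> \<in> space M. f \<omega> \<in> \<F> \<and> P (f \<omega>) \<omega>} = (\<Union>S\<in>\<F>. {\<omega> \<in> space M. f \<omega> = S \<and> P S \<omega>})"
    by auto
  show "{\<omega> \<in> space M. f \<omega> \<in> \<F> \<and> P (f \<omega>) \<omega>} \<in> events"
    unfolding * using fin meas by (intro sets.finite_UN) auto
  show "prob {\<omega> \<in> space M. f \<omega> \<in> \<F> \<and> P (f \<omega>) \<omega>} = (\<Sum>S\<in>\<F>. prob {\<omega> \<in> space M. f \<omega> = S \<and> P S \<omega>})"
    unfolding * using fin meas by (intro finite_measure_finite_Union) (auto simp: disjoint_family_on_def)
qed

text \<open>
  Only finitely many steps are considered, because the increments of a process along a grid come
  with independence of finite families.
\<close>

locale iid_steps = prob_space M for M :: "'a measure" +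
  fixes \<xi> :: "nat \<Rightarrow> 'a \<Rightarrow> real" and m :: nat and \<nu> :: "real measure"
  assumes indep_steps: "indep_vars (\<lambda>_. borel) \<xi> {..<m}"
    and distr_steps: "\<And>j. j < m \<Longrightarrow> distr M borel (\<xi> j) = \<nu>"
    and prob_space_steps: "prob_space \<nu>"
    and sets_steps: "sets \<nu> = sets borel"
begin

sublocale N: prob_space \<nu> by (rule prob_space_steps)

lemma measurable_steps [measurable]: "j < m \<Longrightarrow> \<xi> j \<in> borel_measurable M"
  using indep_steps by (auto simp: indep_vars_def)

lemma prob_steps:
  assumes "j < m" "A \<in> sets borel"
  shows "prob (\<xi> j -` A \<inter> space M) = N.prob A"
  using assms distr_steps[of j, symmetric] by (simp add: measure_distr)

lemma prob_nonzero: "N.prob (- {0}) = 1 - N.prob {0}"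
proof -
  have "N.prob (space \<nu> - {0}) = 1 - N.prob {0}"
    by (rule N.prob_compl) (simp add: sets_steps)
  moreover have "space \<nu> = UNIV" using sets_eq_imp_space_eq[OF sets_steps] by simp
  ultimately show ?thesis by (simp add: Compl_eq_Diff_UNIV)
qed

text \<open>
  Prescribing which steps vanish and where the others lie is a condition on each step separately,
  so independence applies.
\<close>

lemma pattern_prob:
  assumes J: "J \<subseteq> {..<m}" and S: "S \<subseteq> J" and C: "\<And>j. C j \<in> sets borel"
  shows "prob {\<omega> \<in> space M. {j \<in> J. \<xi> j \<omega> \<noteq> 0} = S \<and> (\<forall>j\<in>S. \<xi> j \<omega> \<in> C j)}
      = N.prob {0} ^ (card J - card S) * (\<Prod>j\<in>S. N.prob (C j - {0}))" (is "prob ?E = _")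
    and "{\<omega> \<in> space M. {j \<in> J. \<xi> j \<omega> \<noteq> 0} = S \<and> (\<forall>j\<in>S. \<xi> j \<omega> \<in> C j)} \<in> events"
proof -
  define D where "D j = (if j \<in> S then C j - {0} else {0})" for j
  have D [measurable]: "D j \<in> sets borel" for j using C by (auto simp: D_def)
  have finJ: "finite J" using J finite_subset by auto
  then have finS: "finite S" using S finite_subset by auto
  have E: "?E = {\<omega> \<in> space M. \<forall>j\<in>J. \<xi> j \<omega> \<in> D j}"
    using S by (auto simp: D_def split: if_splits)
  have meas: "{\<omega> \<in> space M. \<xi> j \<omega> \<in> D j} \<in> events" if "j \<in> J" for j
  proof -
    have "\<xi> j \<in> borel_measurable M" using that J by (auto intro: measurable_steps)
    then show ?thesis by measurable
  qed
  then show "?E \<in> events"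
    unfolding E using finJ by (intro sets.sets_Collect_finite_All) auto
  have "prob ?E = (\<Prod>j\<in>J. N.prob (D j))"
  proof (cases "J = {}")
    case True
    then show ?thesis using S by (simp add: prob_space)
  next
    case False
    have "?E = (\<Inter>j\<in>J. \<xi> j -` D j \<inter> space M)"
      unfolding E using False by auto
    also have "prob \<dots> = (\<Prod>j\<in>J. prob (\<xi> j -` D j \<inter> space M))"
      using False finJ J by (intro indep_varsD[OF indep_steps]) auto
    also have "\<dots> = (\<Prod>j\<in>J. N.prob (D j))"
      using J by (intro prod.cong refl prob_steps) auto
    finally show ?thesis .
  qed
  also have "\<dots> = (\<Prod>j\<in>J - S. N.prob (D j)) * (\<Prod>j\<in>S. N.prob (D j))"
    by (rule prod.subset_diff[OF S finJ])
  also have "(\<Prod>j\<in>J - S. N.prob (D j)) = (\<Prod>j\<in>J - S. N.prob {0})"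
    by (intro prod.cong refl) (simp add: D_def)
  also have "\<dots> = N.prob {0} ^ (card J - card S)"
    using S finS by (simp add: card_Diff_subset)
  also have "(\<Prod>j\<in>S. N.prob (D j)) = (\<Prod>j\<in>S. N.prob (C j - {0}))"
    by (intro prod.cong refl) (simp add: D_def)
  finally show "prob ?E = N.prob {0} ^ (card J - card S) * (\<Prod>j\<in>S. N.prob (C j - {0}))" .
qed

lemma support_prob:
  assumes J: "J \<subseteq> {..<m}" and \<F>: "\<F> \<subseteq> Pow J"
  shows "prob {\<omega> \<in> space M. {j \<in> J. \<xi> j \<omega> \<noteq> 0} \<in> \<F>}
      = (\<Sum>S\<in>\<F>. N.prob {0} ^ (card J - card S) * N.prob (- {0}) ^ card S)"
proof -
  have fin: "finite \<F>" using J \<F> by (meson finite_lessThan finite_Pow_iff finite_subset)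
  have "prob {\<omega> \<in> space M. {j \<in> J. \<xi> j \<omega> \<noteq> 0} \<in> \<F> \<and> (\<forall>j\<in>{j \<in> J. \<xi> j \<omega> \<noteq> 0}. \<xi> j \<omega> \<in> UNIV)}
    = (\<Sum>S\<in>\<F>. prob {\<omega> \<in> space M. {j \<in> J. \<xi> j \<omega> \<noteq> 0} = S \<and> (\<forall>j\<in>S. \<xi> j \<omega> \<in> UNIV)})"
    using \<F> by (intro prob_split_finite(1) fin pattern_prob(2)[OF J]) auto
  also have "\<dots> = (\<Sum>S\<in>\<F>. N.prob {0} ^ (card J - card S) * N.prob (- {0}) ^ card S)"
    using \<F> by (intro sum.cong refl) (subst pattern_prob(1)[OF J], auto simp: Compl_eq_Diff_UNIV)
  finally show ?thesis by simp
qed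

lemma binomial_prob:
  assumes J: "J \<subseteq> {..<m}"
  shows "prob {\<omega> \<in> space M. card {j \<in> J. \<xi> j \<omega> \<noteq> 0} = k}
      = real (card J choose k) * (1 - N.prob {0}) ^ k * N.prob {0} ^ (card J - k)"
proof -
  have finJ: "finite J" using J finite_subset by auto
  have "{\<omega> \<in> space M. card {j \<in> J. \<xi> j \<omega> \<noteq> 0} = k}
      = {\<omega> \<in> space M. {j \<in> J. \<xi> j \<omega> \<noteq> 0} \<in> {S. S \<subseteq> J \<and> card S = k}}"
    by auto
  also have "prob \<dots> = (\<Sum>S\<in>{S. S \<subseteq> J \<and> card S = k}. N.prob {0} ^ (card J - card S) * N.prob (- {0}) ^ card S)"
    by (intro support_prob J) auto
  also have "\<dots> = (\<Sum>S\<in>{S. S \<subseteq> J \<and> card S = k}. N.prob {0} ^ (card J - k) * N.prob (- {0}) ^ k)"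
    by (intro sum.cong refl) auto
  finally show ?thesis
    by (simp add: n_subsets[OF finJ] prob_nonzero)
qed

text \<open>
  Given the support of the steps, the \<open>k\<close>-th nonzero step has the law of a step conditioned not to
  vanish, independently for different \<open>k\<close>. Since this conditional law does not depend on the support,
  summing over the supports in \<open>\<F>\<close> factors it out. The sets \<open>B k\<close> are trivial for \<open>k > K\<close>, so only the
  first \<open>K\<close> nonzero steps matter, and these exist because the supports in \<open>\<F>\<close> have at least \<open>K\<close>
  elements.
\<close>

lemma marks_prob:
  assumes \<F>: "\<F> \<subseteq> {S. S \<subseteq> {..<m} \<and> K \<le> card S}"
    and B: "\<And>k. B k \<in> sets borel" "\<And>k. K < k \<Longrightarrow> B k = UNIV"
    and pos: "0 < N.prob (- {0})"
  shows "prob {\<omega> \<in> space M. nonzeros (\<lambda>j. \<xi> j \<omega>) m \<in> \<F> \<and>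
        (\<forall>j\<in>nonzeros (\<lambda>j. \<xi> j \<omega>) m. \<xi> j \<omega> \<in> B (rank_in (nonzeros (\<lambda>j. \<xi> j \<omega>) m) j))}
      = prob {\<omega> \<in> space M. nonzeros (\<lambda>j. \<xi> j \<omega>) m \<in> \<F>} * (\<Prod>k = 1..K. N.prob (B k - {0}) / N.prob (- {0}))"
    and "{\<omega> \<in> space M. nonzeros (\<lambda>j. \<xi> j \<omega>) m \<in> \<F> \<and>
        (\<forall>j\<in>nonzeros (\<lambda>j. \<xi> j \<omega>) m. \<xi> j \<omega> \<in> B (rank_in (nonzeros (\<lambda>j. \<xi> j \<omega>) m) j))} \<in> events"
proof -
  have fin: "finite \<F>" using \<F> by (auto intro: finite_subset[of _ "Pow {..<m}"])
  have nz: "nonzeros (\<lambda>j. \<xi> j \<omega>) m = {j \<in> {..<m}. \<xi> j \<omega> \<noteq> 0}" for \<omega>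
    by (auto simp: nonzeros_def)
  let ?r = "\<lambda>k. N.prob (B k - {0}) / N.prob (- {0})"
  have marks: "(\<Prod>j\<in>S. N.prob (B (rank_in S j) - {0})) = N.prob (- {0}) ^ card S * (\<Prod>k = 1..K. ?r k)"
    if "S \<in> \<F>" for S
  proof -
    have S: "finite S" "K \<le> card S" using that \<F> finite_subset by auto
    have "(\<Prod>j\<in>S. N.prob (B (rank_in S j) - {0})) = (\<Prod>k = 1..card S. N.prob (B k - {0}))"
      by (rule prod.reindex_bij_betw[OF bij_betw_rank[OF S(1)]])
    also have "\<dots> = (\<Prod>k = 1..card S. N.prob (- {0}) * ?r k)"
      using pos by (intro prod.cong refl) auto
    also have "\<dots> = N.prob (- {0}) ^ card S * (\<Prod>k = 1..card S. ?r k)"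
      unfolding prod.distrib by simp
    also have "(\<Prod>k = 1..card S. ?r k) = (\<Prod>k = 1..K. ?r k)"
      using S B(2) pos by (intro prod.mono_neutral_right) (auto simp: Compl_eq_Diff_UNIV[symmetric])
    finally show ?thesis .
  qed
  have "prob {\<omega> \<in> space M. nonzeros (\<lambda>j. \<xi> j \<omega>) m \<in> \<F> \<and>
        (\<forall>j\<in>nonzeros (\<lambda>j. \<xi> j \<omega>) m. \<xi> j \<omega> \<in> B (rank_in (nonzeros (\<lambda>j. \<xi> j \<omega>) m) j))}
     = (\<Sum>S\<in>\<F>. prob {\<omega> \<in> space M. nonzeros (\<lambda>j. \<xi> j \<omega>) m = S \<and> (\<forall>j\<in>S. \<xi> j \<omega> \<in> B (rank_in S j))})"
    unfolding nz using \<F> B by (intro prob_split_finite(1) fin pattern_prob(2)) auto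
  also have "\<dots> = (\<Sum>S\<in>\<F>. N.prob {0} ^ (m - card S) * (\<Prod>j\<in>S. N.prob (B (rank_in S j) - {0})))"
    unfolding nz using \<F> B by (intro sum.cong refl) (subst pattern_prob(1), auto)
  also have "\<dots> = (\<Sum>S\<in>\<F>. N.prob {0} ^ (m - card S) * N.prob (- {0}) ^ card S * (\<Prod>k = 1..K. ?r k))"
    by (intro sum.cong refl) (simp add: marks)
  also have "\<dots> = (\<Sum>S\<in>\<F>. N.prob {0} ^ (m - card S) * N.prob (- {0}) ^ card S) * (\<Prod>k = 1..K. ?r k)"
    by (simp add: sum_distrib_right)
  also have "(\<Sum>S\<in>\<F>. N.prob {0} ^ (m - card S) * N.prob (- {0}) ^ card S) = prob {\<omega> \<in> space M. nonzeros (\<lambda>j. \<xi> j \<omega>) m \<in> \<F>}"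
    unfolding nz using \<F> by (subst support_prob) auto
  finally show "prob {\<omega> \<in> space M. nonzeros (\<lambda>j. \<xi> j \<omega>) m \<in> \<F> \<and>
        (\<forall>j\<in>nonzeros (\<lambda>j. \<xi> j \<omega>) m. \<xi> j \<omega> \<in> B (rank_in (nonzeros (\<lambda>j. \<xi> j \<omega>) m) j))}
      = prob {\<omega> \<in> space M. nonzeros (\<lambda>j. \<xi> j \<omega>) m \<in> \<F>} * (\<Prod>k = 1..K. N.prob (B k - {0}) / N.prob (- {0}))" .
  show "{\<omega> \<in> space M. nonzeros (\<lambda>j. \<xi> j \<omega>) m \<in> \<F> \<and>
        (\<forall>j\<in>nonzeros (\<lambda>j. \<xi> j \<omega>) m. \<xi> j \<omega> \<in> B (rank_in (nonzeros (\<lambda>j. \<xi> j \<omega>) m) j))} \<in> events"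
    unfolding nz using \<F> B by (intro prob_split_finite(2) fin pattern_prob(2)) auto
qed

end

section \<open>Poisson approximation\<close>

lemma LIMSEQ_one_minus_exp: "(\<lambda>n. real (Suc n) * (1 - exp (- c / real (Suc n)))) \<longlonglongrightarrow> c"
proof -
  have "((\<lambda>h. exp (- c * h)) has_real_derivative - c) (at 0)"
    by (auto intro!: derivative_eq_intros)
  from DERIV_D[OF this] have 1: "((\<lambda>h. (exp (- c * h) - 1) / h) \<longlongrightarrow> - c) (at 0)"
    by simp
  have 2: "filterlim (\<lambda>n. 1 / real (Suc n)) (at 0) sequentially"
    using LIMSEQ_mesh by (auto simp: filterlim_at)
  have "(\<lambda>n. - ((exp (- c * (1 / real (Suc n))) - 1) / (1 / real (Suc n)))) \<longlonglongrightarrow> - (- c)"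
    by (rule tendsto_minus[OF filterlim_compose[OF 1 2]])
  moreover have "- ((exp (- c * (1 / real (Suc n))) - 1) / (1 / real (Suc n))) = real (Suc n) * (1 - exp (- c / real (Suc n)))" for n
    by (simp add: field_simps)
  ultimately show ?thesis by simp
qed

text \<open>
  For \<open>c \<ge> 0\<close> this concerns \<open>m n\<close> trials with success probability \<open>q = 1 - exp (-c/(n+1))\<close>, which is asymptotically
  \<open>c/(n+1)\<close>. In the binomial coefficient times \<open>q ^ k\<close> each factor \<open>(m n - i) * q\<close> tends to \<open>c * t\<close>.
\<close>

lemma binomial_tendsto_poisson:
  assumes m: "(\<lambda>n. real (m n) / real (Suc n)) \<longlonglongrightarrow> t"
  shows "(\<lambda>n. real (m n choose k) * (1 - exp (- c / real (Suc n))) ^ k * exp (- c / real (Suc n)) ^ (m n - k))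
    \<longlonglongrightarrow> (c * t) ^ k / fact k * exp (- (c * t))"
proof -
  define q where "q n = 1 - exp (- c / real (Suc n))" for n
  have nq: "(\<lambda>n. real (Suc n) * q n) \<longlonglongrightarrow> c"
    unfolding q_def by (rule LIMSEQ_one_minus_exp)
  have fac: "(\<lambda>n. (real (m n) - real i) * q n) \<longlonglongrightarrow> t * c" for i
  proof -
    have "(\<lambda>n. (real (m n) / real (Suc n) - real i * (1 / real (Suc n))) * (real (Suc n) * q n)) \<longlonglongrightarrow> (t - real i * 0) * c"
      by (intro tendsto_intros m nq LIMSEQ_mesh)
    moreover have "(real (m n) / real (Suc n) - real i * (1 / real (Suc n))) * (real (Suc n) * q n) = (real (m n) - real i) * q n" for n
      by (simp add: field_simps del: of_nat_Suc)
    ultimately show ?thesis by (simp only: mult_zero_right diff_zero)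
  qed
  have e1: "(\<lambda>n. exp (- c / real (Suc n)) ^ m n) \<longlonglongrightarrow> exp (- (c * t))"
  proof -
    have "(\<lambda>n. exp (- (c * (real (m n) / real (Suc n))))) \<longlonglongrightarrow> exp (- (c * t))"
      by (intro tendsto_intros m)
    then show ?thesis by (simp add: exp_of_nat_mult[symmetric] mult.commute)
  qed
  have e2: "(\<lambda>n. exp (- c / real (Suc n)) ^ k) \<longlonglongrightarrow> exp (- c * 0) ^ k"
    using tendsto_power[OF tendsto_exp[OF tendsto_mult[OF tendsto_const LIMSEQ_mesh]], of "- c" k] by simp
  have "(\<lambda>n. (\<Prod>i = 0..<k. (real (m n) - real i) * q n) / fact k * (exp (- c / real (Suc n)) ^ m n / exp (- c / real (Suc n)) ^ k))
      \<longlonglongrightarrow> (\<Prod>i = 0..<k. t * c) / fact k * (exp (- (c * t)) / exp (- c * 0) ^ k)"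
    by (intro tendsto_mult tendsto_divide tendsto_prod tendsto_const fac e1 e2) auto
  moreover have "(\<Prod>i = 0..<k. (real (m n) - real i) * q n) / fact k * (exp (- c / real (Suc n)) ^ m n / exp (- c / real (Suc n)) ^ k)
     = real (m n choose k) * q n ^ k * exp (- c / real (Suc n)) ^ (m n - k)" for n
  proof -
    have "(\<Prod>i = 0..<k. (real (m n) - real i) * q n) / fact k = real (m n choose k) * q n ^ k"
      by (simp add: prod.distrib binomial_gbinomial gbinomial_prod_rev)
    then show ?thesis
      by (cases "k \<le> m n") (simp_all add: power_diff binomial_eq_0)
  qed
  ultimately show ?thesis by (simp add: q_def mult.commute)
qed

section \<open>A subordinator with an atom at zero has step paths\<close>

text \<open>
  An atom strictly between 0 and 1, parametrised by the rate of the compound Poisson process that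
  such a subordinator turns out to be.
\<close>

locale lazy_subordinator = subordinator +
  fixes c :: real
  assumes c_pos: "0 < c"
    and zero_prob: "prob {\<omega> \<in> space M. X 1 \<omega> = 0} = exp (- c)"
begin

abbreviation sample_path :: "'a \<Rightarrow> real \<Rightarrow> real" where
  "sample_path \<omega> \<equiv> \<lambda>t. X t \<omega>"

abbreviation increment :: "nat \<Rightarrow> nat \<Rightarrow> 'a \<Rightarrow> real" where
  "increment n j \<omega> \<equiv> grid_increment (sample_path \<omega>) n j"

definition step_law :: "nat \<Rightarrow> real measure" where
  "step_law n = distr M borel (X (1 / real (Suc n)))"

lemma increment_measurable [measurable]: "increment n j \<in> borel_measurable M"
  unfolding grid_increment_def by measurable

lemma iid_grid: "iid_steps M (increment n) m (step_law n)"
proof (intro iid_steps.intro iid_steps_axioms.intro prob_space_axioms)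
  show "indep_vars (\<lambda>_. borel) (increment n) {..<m}"
    unfolding grid_increment_def
    by (rule independent_increments) (auto simp: grid_Suc)
  show "distr M borel (increment n j) = step_law n" for j
    unfolding grid_increment_def step_law_def
    by (subst stationary_increments) (auto simp: grid_Suc)
  show "prob_space (step_law n)"
    unfolding step_law_def by (rule prob_space_distr) simp
  show "sets (step_law n) = sets borel" by (simp add: step_law_def)
qed

text \<open>
  \<open>X\<close> vanishes at time 1 if and only if all its \<open>n + 1\<close> grid increments up to time 1 vanish, so
  \<open>exp (- c)\<close> is the \<open>(n+1)\<close>-st power of the probability for one increment.
\<close>

lemma step_law_zero: "measure (step_law n) {0} = exp (- c / real (Suc n))"
proof -
  interpret S: iid_steps M "increment n" "Suc n" "step_law n" by (rule iid_grid)
  have "AE \<omega> in M. X 1 \<omega> = 0 \<longleftrightarrow> (\<forall>j\<in>{..<Suc n}. increment n j \<omega> = 0)"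
    using nondecreasing AE_space
  proof eventually_elim
    case (elim \<omega>)
    have "(\<Sum>j<Suc n. increment n j \<omega>) = X (grid n (Suc n)) \<omega> - X (grid n 0) \<omega>"
      unfolding grid_increment_def by (rule sum_lessThan_telescope)
    also have "\<dots> = X 1 \<omega>"
      using elim by (simp add: start_zero grid_def)
    finally have "X 1 \<omega> = (\<Sum>j<Suc n. increment n j \<omega>)" ..
    moreover have "0 \<le> increment n j \<omega>" for j
      using elim grid_mono[of j "Suc j" n] by (simp add: grid_increment_def)
    ultimately show ?case by (simp add: sum_nonneg_eq_0_iff del: sum.lessThan_Suc)
  qed
  then have "exp (- c) = prob {\<omega> \<in> space M. \<forall>j\<in>{..<Suc n}. increment n j \<omega> = 0}"
    unfolding zero_prob[symmetric] by (intro finite_measure_eq_AE) auto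
  also have "{\<omega> \<in> space M. \<forall>j\<in>{..<Suc n}. increment n j \<omega> = 0}
      = {\<omega> \<in> space M. {j \<in> {..<Suc n}. increment n j \<omega> \<noteq> 0} = {} \<and> (\<forall>j\<in>{}. increment n j \<omega> \<in> UNIV)}"
    by auto
  also have "prob \<dots> = measure (step_law n) {0} ^ Suc n"
    by (subst S.pattern_prob(1)) auto
  finally have "measure (step_law n) {0} ^ Suc n = exp (- c / real (Suc n)) ^ Suc n"
    by (simp add: exp_of_nat_mult[symmetric] del: power_Suc of_nat_Suc)
  then show ?thesis
    by (rule power_eq_imp_eq_base) auto
qed

lemma AE_rc_path: "AE \<omega> in M. rc_path (sample_path \<omega>)"
  using nondecreasing AE_space
  by eventually_elim (auto intro!: rc_path.intro simp: start_zero right_continuous)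

definition grid_count :: "nat \<Rightarrow> real \<Rightarrow> 'a \<Rightarrow> nat" where
  "grid_count n t \<omega> = card (nonzeros (\<lambda>j. increment n j \<omega>) (cells n t))"

lemma grid_count_measurable [measurable]: "grid_count n t \<in> measurable M (count_space UNIV)"
proof -
  have "(\<lambda>\<omega>. nat \<lfloor>\<Sum>j<cells n t. indicator (- {0}) (increment n j \<omega>) :: real\<rfloor>) \<in> measurable M (count_space UNIV)"
    by measurable
  then show ?thesis
    unfolding grid_count_def nonzeros_card_eq_sum[symmetric] by simp
qed

text \<open>
  The expected number of nonzero grid increments up to time \<open>T\<close> is at most
  \<open>T (n+1) (1 - exp (-c/(n+1))) \<le> c T\<close>. By Fatou's lemma almost every path has a bound that holds on
  infinitely many grids, which suffices for \<open>finite_values_of_grid_bound\<close>.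
\<close>

lemma AE_finite_values: "AE \<omega> in M. \<forall>t\<ge>0. finite (sample_path \<omega> ` {0..t})"
proof -
  have "AE \<omega> in M. \<exists>K. \<forall>n0. \<exists>n\<ge>n0. grid_count n (real T) \<omega> \<le> K" for T :: nat
  proof -
    let ?u = "\<lambda>n \<omega>. ennreal (real (grid_count n (real T) \<omega>))"
    have bound: "(\<integral>\<^sup>+\<omega>. ?u n \<omega> \<partial>M) \<le> ennreal (c * real T)" for n
    proof -
      interpret S: iid_steps M "increment n" "cells n (real T)" "step_law n" by (rule iid_grid)
      have "(\<integral>\<^sup>+\<omega>. ?u n \<omega> \<partial>M) = (\<integral>\<^sup>+\<omega>. (\<Sum>j<cells n (real T). ennreal (indicator (- {0}) (increment n j \<omega>))) \<partial>M)"
        unfolding grid_count_def nonzeros_card_eq_sum by (simp add: sum_ennreal)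
      also have "\<dots> = (\<Sum>j<cells n (real T). \<integral>\<^sup>+\<omega>. ennreal (indicator (- {0}) (increment n j \<omega>)) \<partial>M)"
        by (rule nn_integral_sum) measurable
      also have "\<dots> = (\<Sum>j<cells n (real T). ennreal (1 - exp (- c / real (Suc n))))"
      proof (intro sum.cong refl)
        fix j assume j: "j \<in> {..<cells n (real T)}"
        have "(\<integral>\<^sup>+\<omega>. ennreal (indicator (- {0}) (increment n j \<omega>)) \<partial>M)
            = (\<integral>\<^sup>+\<omega>. indicator (increment n j -` (- {0}) \<inter> space M) \<omega> \<partial>M)"
          by (intro nn_integral_cong) (auto split: split_indicator)
        also have "\<dots> = ennreal (prob (increment n j -` (- {0}) \<inter> space M))"
          by (subst nn_integral_indicator) (auto simp: emeasure_eq_measure)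
        also have "prob (increment n j -` (- {0}) \<inter> space M) = 1 - exp (- c / real (Suc n))"
          using j by (subst S.prob_steps) (auto simp: S.prob_nonzero step_law_zero)
        finally show "(\<integral>\<^sup>+\<omega>. ennreal (indicator (- {0}) (increment n j \<omega>)) \<partial>M) = ennreal (1 - exp (- c / real (Suc n)))" .
      qed
      also have "\<dots> = ennreal (real (cells n (real T)) * (1 - exp (- c / real (Suc n))))"
        using c_pos by (simp add: ennreal_of_nat_eq_real_of_nat ennreal_mult[symmetric])
      also have "\<dots> \<le> ennreal (c * real T)"
      proof (rule ennreal_leI)
        have "1 - exp (- c / real (Suc n)) \<le> c / real (Suc n)"
          using exp_ge_add_one_self[of "- c / real (Suc n)"] by simp
        then have "real (cells n (real T)) * (1 - exp (- c / real (Suc n))) \<le> real (cells n (real T)) * (c / real (Suc n))"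
          by (rule mult_left_mono) simp
        also have "\<dots> = c * real T"
        proof -
          \<comment> \<open>An integer time is a grid point, so no rounding occurs.\<close>
          have "real T * real (Suc n) = real (T * Suc n)" by (rule of_nat_mult[symmetric])
          then have "cells n (real T) = T * Suc n" unfolding cells_def by (simp only: ceiling_of_nat nat_int)
          then show ?thesis by (simp del: of_nat_Suc mult_Suc_right)
        qed
        finally show "real (cells n (real T)) * (1 - exp (- c / real (Suc n))) \<le> c * real T" .
      qed
      finally show ?thesis .
    qed
    have "(\<integral>\<^sup>+\<omega>. liminf (\<lambda>n. ?u n \<omega>) \<partial>M) \<le> liminf (\<lambda>n. \<integral>\<^sup>+\<omega>. ?u n \<omega> \<partial>M)"
      by (rule nn_integral_liminf) measurable
    also have "\<dots> \<le> ennreal (c * real T)"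
      by (rule order_trans[OF Liminf_mono[where g = "\<lambda>_. ennreal (c * real T)"]]) (auto simp: bound Liminf_const)
    finally have "(\<integral>\<^sup>+\<omega>. liminf (\<lambda>n. ?u n \<omega>) \<partial>M) \<noteq> \<infinity>"
      by (auto simp: top_unique)
    then have "AE \<omega> in M. liminf (\<lambda>n. ?u n \<omega>) \<noteq> \<infinity>"
      by (intro nn_integral_PInf_AE) measurable
    then show ?thesis
    proof eventually_elim
      case (elim \<omega>)
      then obtain K :: nat where K: "liminf (\<lambda>n. ?u n \<omega>) < of_nat K"
        using ennreal_Ex_less_of_nat by (auto simp: less_top)
      show ?case
      proof (rule exI[of _ K], rule ccontr)
        assume "\<not> (\<forall>n0. \<exists>n\<ge>n0. grid_count n (real T) \<omega> \<le> K)"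
        then have "eventually (\<lambda>n. of_nat K \<le> ?u n \<omega>) sequentially"
          unfolding eventually_sequentially
          by (metis ennreal_of_nat_eq_real_of_nat less_imp_le not_le of_nat_le_iff)
        from Liminf_bounded[OF this] K show False by simp
      qed
    qed
  qed
  then have "AE \<omega> in M. \<forall>T. \<exists>K. \<forall>n0. \<exists>n\<ge>n0. grid_count n (real T) \<omega> \<le> K"
    by (simp add: AE_all_countable)
  with AE_rc_path show ?thesis
  proof eventually_elim
    case (elim \<omega>)
    then interpret rc_path "sample_path \<omega>" by simp
    show ?case
    proof (intro allI impI)
      fix t :: real assume t: "0 \<le> t"
      obtain T :: nat where T: "t \<le> real T" using real_arch_simple by blast
      obtain K where "\<And>n0. \<exists>n\<ge>n0. grid_count n (real T) \<omega> \<le> K" using elim by blast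
      then have "finite (sample_path \<omega> ` {0..real T})"
        by (intro finite_values_of_grid_bound) (auto simp: grid_count_def)
      then show "finite (sample_path \<omega> ` {0..t})"
        by (rule finite_subset[rotated]) (use T in auto)
    qed
  qed
qed

text \<open>
  The range is infinite since the path is unbounded.
\<close>

lemma AE_step_path: "AE \<omega> in M. step_path (sample_path \<omega>)"
proof -
  have "emeasure M {\<omega> \<in> space M. X 1 \<omega> = 0} < 1"
    using c_pos zero_prob by (simp add: emeasure_eq_measure ennreal_1[symmetric] ennreal_less_iff del: ennreal_1)
  from AE_unbounded[OF this] AE_finite_values AE_rc_path show ?thesis
  proof eventually_elim
    case (elim \<omega>)
    have "infinite (sample_path \<omega> ` {0..})"
    proof
      assume fin: "finite (sample_path \<omega> ` {0..})"
      obtain b :: nat where b: "Max (sample_path \<omega> ` {0..}) \<le> real b" using real_arch_simple by blast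
      obtain n :: nat where "real b < X (real n) \<omega>" using elim(1) by blast
      moreover have "X (real n) \<omega> \<le> Max (sample_path \<omega> ` {0..})" using fin by (intro Max_ge) auto
      ultimately show False using b by linarith
    qed
    then show ?case
      using elim by (intro step_path.intro step_path_axioms.intro) auto
  qed
qed

text \<open>
  A measurable set of full measure on which the paths are step functions. Off this set the counting
  process and the jumps are set to 0, because right-continuity and left limits of a Levy process are
  required of every path.
\<close>

definition good :: "'a set" where
  "good = (SOME G. G \<in> events \<and> prob G = 1 \<and> (\<forall>\<omega>\<in>G. step_path (sample_path \<omega>)))"

lemma good_events [measurable]: "good \<in> events" and prob_good: "prob good = 1"
  and good_step_path: "\<omega> \<in> good \<Longrightarrow> step_path (sample_path \<omega>)"
proof -
  obtain N where N: "N \<in> null_sets M" "{\<omega> \<in> space M. \<not> step_path (sample_path \<omega>)} \<subseteq> N"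
    using AE_step_path unfolding eventually_ae_filter by blast
  have "prob (space M - N) = 1"
    using N by (subst prob_compl) (auto simp: measure_eq_0_null_sets)
  then have "\<exists>G. G \<in> events \<and> prob G = 1 \<and> (\<forall>\<omega>\<in>G. step_path (sample_path \<omega>))"
    using N by (intro exI[of _ "space M - N"]) auto
  from someI_ex[OF this] show "good \<in> events" "prob good = 1" "\<omega> \<in> good \<Longrightarrow> step_path (sample_path \<omega>)"
    unfolding good_def by auto
qed

lemma AE_good: "AE \<omega> in M. \<omega> \<in> good"
  using prob_good by (simp add: prob_eq_1)

definition num_jumps :: "real \<Rightarrow> 'a \<Rightarrow> nat" where
  "num_jumps t \<omega> = (if \<omega> \<in> good then jump_count (sample_path \<omega>) t else 0)"

definition mark :: "nat \<Rightarrow> 'a \<Rightarrow> real" where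
  "mark k \<omega> = (if \<omega> \<in> good then jump_size (sample_path \<omega>) k else 0)"

lemma num_jumps_mono: "0 \<le> s \<Longrightarrow> s \<le> t \<Longrightarrow> num_jumps s \<omega> \<le> num_jumps t \<omega>"
  using step_path.jump_count_mono[OF good_step_path] by (simp add: num_jumps_def)

lemma grid_count_eventually:
  "\<omega> \<in> good \<Longrightarrow> 0 \<le> t \<Longrightarrow> eventually (\<lambda>n. grid_count n t \<omega> = num_jumps t \<omega>) sequentially"
  using step_path.grid_jumps[OF good_step_path, of \<omega> t]
  by (auto simp: grid_count_def num_jumps_def elim!: eventually_mono)

lemma num_jumps_measurable [measurable]: 
  assumes "0 \<le> t"
  shows "num_jumps t \<in> measurable M (count_space UNIV)"
proof -
  have "(\<lambda>\<omega>. real (num_jumps t \<omega>)) \<in> borel_measurable M"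
  proof (rule borel_measurable_LIMSEQ_real)
    fix \<omega>
    show "(\<lambda>n. indicator good \<omega> * real (grid_count n t \<omega>)) \<longlonglongrightarrow> real (num_jumps t \<omega>)"
    proof (cases "\<omega> \<in> good")
      case True
      show ?thesis
        using grid_count_eventually[OF True assms] True
        by (intro tendsto_eventually) (auto elim!: eventually_mono)
    qed (simp add: num_jumps_def)
  qed measurable
  then have "(\<lambda>\<omega>. nat \<lfloor>real (num_jumps t \<omega>)\<rfloor>) \<in> measurable M (count_space UNIV)"
    by measurable
  then show ?thesis by simp
qed

text \<open>
  The value of the path after \<open>k\<close> jumps is observed at some grid point, because it persists for a
  positive time. So countably many time points decide about it.
\<close>

lemma mark_measurable [measurable]: "mark k \<in> borel_measurable M"
proof -
  have lev: "(\<lambda>\<omega>. if \<omega> \<in> good then level (sample_path \<omega>) k else 0) \<in> borel_measurable M" for k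
  proof (rule measurableI)
    fix A :: "real set" assume [measurable]: "A \<in> sets borel"
    let ?f = "\<lambda>\<omega>. if \<omega> \<in> good then level (sample_path \<omega>) k else 0"
    have "level (sample_path \<omega>) k \<in> A \<longleftrightarrow> (\<exists>n j. num_jumps (grid n j) \<omega> = k \<and> X (grid n j) \<omega> \<in> A)"
      if good: "\<omega> \<in> good" for \<omega>
    proof -
      interpret step_path "sample_path \<omega>" using good by (rule good_step_path)
      have val: "level (sample_path \<omega>) k = X s \<omega>" if "num_jumps s \<omega> = k" "0 \<le> s" for s
        using that good level_jump_count[of s] by (simp add: num_jumps_def)
      have "\<exists>n j. num_jumps (grid n j) \<omega> = k"
      proof -
        obtain t where t: "0 \<le> t" "jump_count (sample_path \<omega>) t = k" using jump_count_surj by blast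
        obtain d where d: "0 < d" "\<And>s. t \<le> s \<Longrightarrow> s < t + d \<Longrightarrow> X s \<omega> = X t \<omega>"
          using locally_constant[OF t(1)] by blast
        have "eventually (\<lambda>n. grid n (cells n t) < t + d) sequentially"
          by (rule order_tendstoD(2)[OF grid_cells_tendsto[OF t(1)]]) (use d in simp)
        then obtain n where "grid n (cells n t) < t + d"
          using eventually_happens by force
        then have "X (grid n (cells n t)) \<omega> = X t \<omega>"
          using grid_cells[OF t(1), of n] by (intro d(2)) auto
        then show ?thesis
          using t good jump_count_cong[of "grid n (cells n t)" t] by (auto simp: num_jumps_def)
      qed
      then show ?thesis using val by (metis grid_nonneg)
    qed
    then have "?f -` A \<inter> space M = {\<omega> \<in> space M. (\<omega> \<in> good \<and> (\<exists>n j. num_jumps (grid n j) \<omega> = k \<and> X (grid n j) \<omega> \<in> A)) \<or> (\<omega> \<notin> good \<and> 0 \<in> A)}"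
      by (intro set_eqI) (simp add: conj_commute)
    also have "\<dots> \<in> events" by measurable
    finally show "?f -` A \<inter> space M \<in> events" .
  qed simp
  have "mark k = (\<lambda>\<omega>. (if \<omega> \<in> good then level (sample_path \<omega>) k else 0) - (if \<omega> \<in> good then level (sample_path \<omega>) (k - 1) else 0))"
    by (auto simp: mark_def jump_size_def)
  then show ?thesis using lev by simp
qed

end

section \<open>The number of jumps is a Poisson process\<close>

context lazy_subordinator
begin

lemma mesh_count_tendsto:
  assumes "0 \<le> s" "s \<le> t"
  shows "(\<lambda>n. real (cells n t - cells n s) / real (Suc n)) \<longlonglongrightarrow> t - s"
proof -
  have "(\<lambda>n. grid n (cells n t) - grid n (cells n s)) \<longlonglongrightarrow> t - s"
    using assms by (intro tendsto_diff grid_cells_tendsto) auto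
  moreover have "grid n (cells n t) - grid n (cells n s) = real (cells n t - cells n s) / real (Suc n)" for n
    using cells_mono[OF assms(2), of n] by (simp add: grid_def diff_divide_distrib of_nat_diff)
  ultimately show ?thesis by simp
qed

lemma grid_count_diff:
  assumes "s \<le> t"
  shows "grid_count n t \<omega> - grid_count n s \<omega> = card {j \<in> {cells n s..<cells n t}. increment n j \<omega> \<noteq> 0}"
proof -
  have "nonzeros (\<lambda>j. increment n j \<omega>) (cells n t)
      = nonzeros (\<lambda>j. increment n j \<omega>) (cells n s) \<union> {j \<in> {cells n s..<cells n t}. increment n j \<omega> \<noteq> 0}"
    using cells_mono[OF assms, of n] by (auto simp: nonzeros_def)
  also have "card \<dots> = grid_count n s \<omega> + card {j \<in> {cells n s..<cells n t}. increment n j \<omega> \<noteq> 0}"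
    unfolding grid_count_def by (intro card_Un_disjoint) (auto simp: nonzeros_def)
  finally show ?thesis by (simp add: grid_count_def)
qed

lemma AE_grid_count_diff_eventually:
  assumes "0 \<le> s" "0 \<le> t"
  shows "AE \<omega> in M. eventually (\<lambda>n. grid_count n t \<omega> - grid_count n s \<omega> = num_jumps t \<omega> - num_jumps s \<omega>) sequentially"
  using AE_good
proof eventually_elim
  case (elim \<omega>)
  from grid_count_eventually[OF elim assms(1)] grid_count_eventually[OF elim assms(2)]
  show ?case by eventually_elim simp
qed

text \<open>
  The grid counts of nonzero increments between \<open>s\<close> and \<open>t\<close> are binomial and eventually equal to the
  number of jumps.
\<close>

lemma jump_increment_prob:
  assumes st: "0 \<le> s" "s \<le> t"
  shows "prob {\<omega> \<in> space M. num_jumps t \<omega> - num_jumps s \<omega> = k}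
      = (c * (t - s)) ^ k / fact k * exp (- (c * (t - s)))"
proof -
  let ?m = "\<lambda>n. cells n t - cells n s"
  have t: "0 \<le> t" using st by simp
  note [measurable] = num_jumps_measurable[OF st(1)] num_jumps_measurable[OF t]
  have "(\<lambda>n. prob {\<omega> \<in> space M. grid_count n t \<omega> - grid_count n s \<omega> = k})
      \<longlonglongrightarrow> prob {\<omega> \<in> space M. num_jumps t \<omega> - num_jumps s \<omega> = k}"
  proof (rule prob_tendsto_of_eventually_eq)
    show "AE \<omega> in M. eventually (\<lambda>n. (grid_count n t \<omega> - grid_count n s \<omega> = k) = (num_jumps t \<omega> - num_jumps s \<omega> = k)) sequentially"
      using AE_grid_count_diff_eventually[OF st(1) t] by eventually_elim (auto elim!: eventually_mono)
  qed measurable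
  moreover have "prob {\<omega> \<in> space M. grid_count n t \<omega> - grid_count n s \<omega> = k}
      = real (?m n choose k) * (1 - exp (- c / real (Suc n))) ^ k * exp (- c / real (Suc n)) ^ (?m n - k)" for n
  proof -
    interpret S: iid_steps M "increment n" "cells n t" "step_law n" by (rule iid_grid)
    show ?thesis
      unfolding grid_count_diff[OF st(2)]
      by (subst S.binomial_prob) (auto simp: step_law_zero)
  qed
  ultimately show ?thesis
    using binomial_tendsto_poisson[OF mesh_count_tendsto[OF st], of k c] by (auto intro: LIMSEQ_unique)
qed

lemma jump_increment_distr:
  assumes st: "0 \<le> s" "s < t"
  shows "distr M (count_space UNIV) (\<lambda>\<omega>. num_jumps t \<omega> - num_jumps s \<omega>) = measure_pmf (poisson_pmf (c * (t - s)))"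
proof (rule measure_eqI_countable)
  fix k :: nat
  have [measurable]: "num_jumps s \<in> measurable M (count_space UNIV)" "num_jumps t \<in> measurable M (count_space UNIV)"
    using st by auto
  have "emeasure (distr M (count_space UNIV) (\<lambda>\<omega>. num_jumps t \<omega> - num_jumps s \<omega>)) {k}
      = emeasure M {\<omega> \<in> space M. num_jumps t \<omega> - num_jumps s \<omega> = k}"
    by (subst emeasure_distr) (auto simp: vimage_def Int_def conj_commute)
  also have "\<dots> = emeasure (measure_pmf (poisson_pmf (c * (t - s)))) {k}"
    using st c_pos by (simp add: emeasure_eq_measure jump_increment_prob emeasure_pmf_single)
  finally show "emeasure (distr M (count_space UNIV) (\<lambda>\<omega>. num_jumps t \<omega> - num_jumps s \<omega>)) {k}
      = emeasure (measure_pmf (poisson_pmf (c * (t - s)))) {k}" .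
qed auto

lemma num_jumps_0 [simp]: "num_jumps 0 \<omega> = 0"
  using step_path.jump_count_0[OF good_step_path] by (simp add: num_jumps_def)

text \<open>
  On each grid the counts over successive time intervals depend on disjoint blocks of increments.
\<close>

lemma jump_increments_indep:
  assumes t0: "0 \<le> t 0" and t: "\<And>i. i < n \<Longrightarrow> t i < t (Suc i)"
  shows "indep_vars (\<lambda>_. count_space UNIV) (\<lambda>i \<omega>. num_jumps (t (Suc i)) \<omega> - num_jumps (t i) \<omega>) {..<n}"
proof (rule indep_vars_of_eventually_eq)
  have tmono: "t i \<le> t j" if "i \<le> j" "j \<le> n" for i j
    using that
  proof (induction j rule: dec_induct)
    case (step j)
    then show ?case using t[of j] by fastforce
  qed simp
  have tpos: "0 \<le> t i" if "i \<le> n" for i using tmono[of 0 i] t0 that by simp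
  let ?J = "\<lambda>N i. {cells N (t i)..<cells N (t (Suc i))}"
  show "indep_vars (\<lambda>_. count_space UNIV) (\<lambda>i \<omega>. grid_count N (t (Suc i)) \<omega> - grid_count N (t i) \<omega>) {..<n}" for N
  proof -
    interpret S: iid_steps M "increment N" "cells N (t n)" "step_law N" by (rule iid_grid)
    have "indep_vars (\<lambda>i. PiM (?J N i) (\<lambda>_. borel)) (\<lambda>i \<omega>. \<lambda>j\<in>?J N i. increment N j \<omega>) {..<n}"
    proof (rule indep_vars_restrict[OF S.indep_steps])
      show "?J N i \<subseteq> {..<cells N (t n)}" if "i \<in> {..<n}" for i
        using cells_mono[OF tmono[of "Suc i" n], of N] that by auto
      have "?J N i \<inter> ?J N j = {}" if "i < j" "j < n" for i j
        using cells_mono[OF tmono[of "Suc i" j], of N] that by auto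
      then show "disjoint_family_on (?J N) {..<n}"
        unfolding disjoint_family_on_def by (metis Int_commute lessThan_iff linorder_neqE_nat)
    qed
    then have "indep_vars (\<lambda>_. count_space UNIV)
        (\<lambda>i \<omega>. nat \<lfloor>\<Sum>j\<in>?J N i. indicator (- {0}) ((\<lambda>j\<in>?J N i. increment N j \<omega>) j) :: real\<rfloor>) {..<n}"
      by (rule indep_vars_compose2[where Y = "\<lambda>i f. nat \<lfloor>\<Sum>j\<in>?J N i. indicator (- {0}) (f j) :: real\<rfloor>"]) measurable
    also have "?this \<longleftrightarrow> ?thesis"
    proof (intro indep_vars_cong refl ext)
      fix i \<omega> assume i: "i \<in> {..<n}"
      have "(\<Sum>j\<in>?J N i. indicator (- {0}) ((\<lambda>j\<in>?J N i. increment N j \<omega>) j) :: real)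
          = (\<Sum>j\<in>?J N i. if increment N j \<omega> \<noteq> 0 then 1 else 0)"
        by (intro sum.cong) (auto split: split_indicator)
      also have "\<dots> = real (card {j \<in> ?J N i. increment N j \<omega> \<noteq> 0})"
        by (simp add: sum.If_cases Int_def)
      finally show "nat \<lfloor>\<Sum>j\<in>?J N i. indicator (- {0}) ((\<lambda>j\<in>?J N i. increment N j \<omega>) j) :: real\<rfloor>
          = grid_count N (t (Suc i)) \<omega> - grid_count N (t i) \<omega>"
        using i t[of i] by (subst grid_count_diff) auto
    qed
    finally show ?thesis .
  qed
  show "AE \<omega> in M. eventually (\<lambda>N. grid_count N (t (Suc i)) \<omega> - grid_count N (t i) \<omega>
      = num_jumps (t (Suc i)) \<omega> - num_jumps (t i) \<omega>) sequentially" if "i \<in> {..<n}" for i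
    using that by (intro AE_grid_count_diff_eventually tpos) auto
  show "random_variable (count_space UNIV) (\<lambda>\<omega>. num_jumps (t (Suc i)) \<omega> - num_jumps (t i) \<omega>)" if "i \<in> {..<n}" for i
  proof -
    have [measurable]: "num_jumps (t i) \<in> measurable M (count_space UNIV)"
      "num_jumps (t (Suc i)) \<in> measurable M (count_space UNIV)"
      using that by (auto intro!: num_jumps_measurable tpos)
    show ?thesis by measurable
  qed
qed simp

lemma num_jumps_poisson_process: "poisson_process M num_jumps c"
proof (intro poisson_process.intro levy_process.intro levy_process_axioms.intro poisson_process_axioms.intro prob_space_axioms)
  show "random_variable borel (\<lambda>\<omega>. real (num_jumps t \<omega>))" if "0 \<le> t" for t
    using num_jumps_measurable[OF that] by measurable
  show "indep_vars (\<lambda>_. borel) (\<lambda>i \<omega>. real (num_jumps (t (Suc i)) \<omega>) - real (num_jumps (t i) \<omega>)) {..<n}"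
    if t: "0 \<le> t 0" "\<And>i. i < n \<Longrightarrow> t i < t (Suc i)" for t :: "nat \<Rightarrow> real" and n
  proof -
    have tpos: "0 \<le> t i" if "i \<le> n" for i
      using that
    proof (induction i)
      case (Suc i)
      then show ?case using t(2)[of i] by simp
    qed (use t in simp)
    have "indep_vars (\<lambda>_. borel) (\<lambda>i \<omega>. real (num_jumps (t (Suc i)) \<omega> - num_jumps (t i) \<omega>)) {..<n}"
      by (rule indep_vars_compose2[OF jump_increments_indep[of t n], where Y = "\<lambda>_ k. real k"]) (use t in auto)
    also have "?this \<longleftrightarrow> ?thesis"
      by (intro indep_vars_cong refl ext of_nat_diff num_jumps_mono tpos less_imp_le t) auto
    finally show ?thesis .
  qed
  show "distr M borel (\<lambda>\<omega>. real (num_jumps t \<omega>) - real (num_jumps s \<omega>)) = distr M borel (\<lambda>\<omega>. real (num_jumps (t - s) \<omega>))"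
    if st: "0 \<le> s" "s \<le> t" for s t
  proof (cases "s = t")
    case False
    have real_distr: "distr M borel (\<lambda>\<omega>. real (D \<omega>)) = distr (distr M (count_space UNIV) D) borel real"
      if "D \<in> measurable M (count_space UNIV)" for D :: "'a \<Rightarrow> nat"
      using that by (subst distr_distr) (auto simp: comp_def)
    have [measurable]: "num_jumps s \<in> measurable M (count_space UNIV)" "num_jumps t \<in> measurable M (count_space UNIV)"
      "num_jumps (t - s) \<in> measurable M (count_space UNIV)"
      using st by auto
    have "(\<lambda>\<omega>. real (num_jumps t \<omega>) - real (num_jumps s \<omega>)) = (\<lambda>\<omega>. real (num_jumps t \<omega> - num_jumps s \<omega>))"
      using num_jumps_mono[OF st] by (intro ext) (simp add: of_nat_diff)
    then have "distr M borel (\<lambda>\<omega>. real (num_jumps t \<omega>) - real (num_jumps s \<omega>))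
        = distr (measure_pmf (poisson_pmf (c * (t - s)))) borel real"
      using st False by (simp add: real_distr jump_increment_distr)
    also have "\<dots> = distr M borel (\<lambda>\<omega>. real (num_jumps (t - s) \<omega>))"
      using st False jump_increment_distr[of 0 "t - s"] by (simp add: real_distr)
    finally show ?thesis .
  qed simp
  show "((\<lambda>s. prob {\<omega> \<in> space M. \<epsilon> < \<bar>real (num_jumps s \<omega>) - real (num_jumps t \<omega>)\<bar>}) \<longlongrightarrow> 0) (at t within {0..})"
    if t: "0 \<le> t" and \<epsilon>: "0 < \<epsilon>" for t \<epsilon>
  proof (rule tendsto_sandwich[where f = "\<lambda>_. 0" and h = "\<lambda>s. c * \<bar>s - t\<bar>"])
    have bound: "prob {\<omega> \<in> space M. \<epsilon> < \<bar>real (num_jumps s \<omega>) - real (num_jumps t \<omega>)\<bar>} \<le> c * \<bar>s - t\<bar>"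
      if s: "0 \<le> s" for s
    proof -
      define u v where "u = min s t" and "v = max s t"
      have uv: "0 \<le> u" "u \<le> v" "v - u = \<bar>s - t\<bar>" using s t by (auto simp: u_def v_def)
      then have v: "0 \<le> v" by simp
      note [measurable] = num_jumps_measurable[OF uv(1)] num_jumps_measurable[OF v]
      have "prob {\<omega> \<in> space M. \<epsilon> < \<bar>real (num_jumps s \<omega>) - real (num_jumps t \<omega>)\<bar>}
          \<le> prob (space M - {\<omega> \<in> space M. num_jumps v \<omega> - num_jumps u \<omega> = 0})"
      proof (rule finite_measure_mono)
        show "{\<omega> \<in> space M. \<epsilon> < \<bar>real (num_jumps s \<omega>) - real (num_jumps t \<omega>)\<bar>}
            \<subseteq> space M - {\<omega> \<in> space M. num_jumps v \<omega> - num_jumps u \<omega> = 0}"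
        proof safe
          fix \<omega> assume gt: "\<epsilon> < \<bar>real (num_jumps s \<omega>) - real (num_jumps t \<omega>)\<bar>"
            and "num_jumps v \<omega> - num_jumps u \<omega> = 0"
          then have "num_jumps v \<omega> = num_jumps u \<omega>"
            using num_jumps_mono[OF uv(1,2), of \<omega>] by simp
          then have "num_jumps s \<omega> = num_jumps t \<omega>"
            by (auto simp: u_def v_def min_def max_def split: if_splits)
          then show False using gt \<epsilon> by simp
        qed
      qed measurable
      also have "\<dots> = 1 - prob {\<omega> \<in> space M. num_jumps v \<omega> - num_jumps u \<omega> = 0}"
        by (rule prob_compl) measurable
      also have "\<dots> = 1 - exp (- (c * \<bar>s - t\<bar>))"
        using jump_increment_prob[OF uv(1,2), of 0] uv(3) by simp
      also have "\<dots> \<le> c * \<bar>s - t\<bar>"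
        using exp_ge_add_one_self[of "- (c * \<bar>s - t\<bar>)"] by simp
      finally show ?thesis .
    qed
    show "eventually (\<lambda>s. prob {\<omega> \<in> space M. \<epsilon> < \<bar>real (num_jumps s \<omega>) - real (num_jumps t \<omega>)\<bar>} \<le> c * \<bar>s - t\<bar>) (at t within {0..})"
      using bound by (auto simp: eventually_at_filter)
    have "((\<lambda>s. c * \<bar>s - t\<bar>) \<longlongrightarrow> c * \<bar>t - t\<bar>) (at t within {0..})"
      by (intro tendsto_intros)
    then show "((\<lambda>s. c * \<bar>s - t\<bar>) \<longlongrightarrow> 0) (at t within {0..})" by simp
  qed auto
  show "continuous (at_right t) (\<lambda>s. real (num_jumps s \<omega>))" if t: "0 \<le> t" for \<omega> t
  proof (cases "\<omega> \<in> good")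
    case True
    then interpret step_path "sample_path \<omega>" by (rule good_step_path)
    obtain d where d: "0 < d" "\<And>s. t \<le> s \<Longrightarrow> s < t + d \<Longrightarrow> X s \<omega> = X t \<omega>"
      using locally_constant[OF t] by blast
    have "eventually (\<lambda>s. s < t + d) (at_right t)"
      using d(1) by (intro eventually_at_rightI[of t "t + d"]) auto
    then have "eventually (\<lambda>s. real (num_jumps s \<omega>) = real (num_jumps t \<omega>)) (at_right t)"
      using eventually_at_right_less[of t]
    proof eventually_elim
      case (elim s)
      then show ?case
        using True jump_count_cong[of s t] d(2)[of s] by (simp add: num_jumps_def)
    qed
    then show ?thesis
      unfolding continuous_within by (rule tendsto_eventually)
  qed (simp add: num_jumps_def)
  show "\<exists>l. ((\<lambda>s. real (num_jumps s \<omega>)) \<longlongrightarrow> l) (at_left t)" if t: "0 < t" for \<omega> t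
  proof (cases "\<omega> \<in> good")
    case True
    then interpret step_path "sample_path \<omega>" by (rule good_step_path)
    obtain r where r: "0 \<le> r" "r < t" "\<And>s. r \<le> s \<Longrightarrow> s < t \<Longrightarrow> jump_count (sample_path \<omega>) s = jump_count (sample_path \<omega>) r"
      using jump_count_left_limit[OF t] by blast
    have "eventually (\<lambda>s. r < s \<and> s < t) (at_left t)"
      using r by (intro eventually_at_leftI[of r]) auto
    then have "eventually (\<lambda>s. real (num_jumps s \<omega>) = real (num_jumps r \<omega>)) (at_left t)"
    proof eventually_elim
      case (elim s)
      then show ?case using True r(3)[of s] by (simp add: num_jumps_def)
    qed
    then have "((\<lambda>s. real (num_jumps s \<omega>)) \<longlongrightarrow> real (num_jumps r \<omega>)) (at_left t)"
      by (rule tendsto_eventually)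
    then show ?thesis ..
  qed (auto simp: num_jumps_def)
  show "distr M (count_space UNIV) (num_jumps t) = measure_pmf (poisson_pmf (c * t))" if "0 < t" for t
    using jump_increment_distr[of 0 t] that by simp
qed (use c_pos in auto)

end

section \<open>Jump sizes are independent of each other and of the number of jumps\<close>

context lazy_subordinator
begin

text \<open>
  The law of a grid increment, conditioned not to vanish.
\<close>

definition jump_ratio :: "nat \<Rightarrow> real set \<Rightarrow> real" where
  "jump_ratio n B = measure (step_law n) (B - {0}) / measure (step_law n) (- {0})"

text \<open>
  The sets of positions of nonzero grid increments up to time \<open>T\<close> that on a fine grid describe the event
  \<open>num_jumps t \<in> A t\<close> for \<open>t \<in> J\<close> together with at least \<open>K\<close> jumps up to time \<open>T\<close>.
\<close>

definition supports :: "nat \<Rightarrow> real \<Rightarrow> real set \<Rightarrow> (real \<Rightarrow> nat set) \<Rightarrow> nat \<Rightarrow> nat set set" where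
  "supports n T J A K =
    {S. S \<subseteq> {..<cells n T} \<and> K \<le> card S \<and> (\<forall>t\<in>J. card (S \<inter> {..<cells n t}) \<in> A t)}"

lemma step_law_nonzero: "measure (step_law n) (- {0}) = 1 - exp (- c / real (Suc n))"
proof -
  interpret S: iid_steps M "increment n" 0 "step_law n" by (rule iid_grid)
  show ?thesis by (simp add: S.prob_nonzero step_law_zero)
qed

lemma step_law_nonzero_pos: "0 < measure (step_law n) (- {0})"
  using c_pos by (simp add: step_law_nonzero)

lemma jump_ratio_UNIV [simp]: "jump_ratio n UNIV = 1"
  using step_law_nonzero_pos[of n] by (simp add: jump_ratio_def Compl_eq_Diff_UNIV[symmetric])

lemma num_jumps_in [measurable]: "0 \<le> t \<Longrightarrow> {\<omega> \<in> space M. num_jumps t \<omega> \<in> A} \<in> events"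
  using measurable_sets[OF num_jumps_measurable, of t A] by (simp add: vimage_def Int_def conj_commute)

lemma counts_events:
  assumes "finite J" "J \<subseteq> {0..}"
  shows "{\<omega> \<in> space M. \<forall>t\<in>J. num_jumps t \<omega> \<in> A t} \<in> events"
  using assms by (intro sets.sets_Collect_finite_All num_jumps_in) auto

lemma marks_events:
  assumes "finite I" "\<And>k. k \<in> I \<Longrightarrow> B k \<in> sets borel"
  shows "{\<omega> \<in> space M. \<forall>k\<in>I. mark k \<omega> \<in> B k} \<in> events"
proof (intro sets.sets_Collect_finite_All assms(1))
  fix k assume "k \<in> I"
  then show "{\<omega> \<in> space M. mark k \<omega> \<in> B k} \<in> events"
    using measurable_sets[OF mark_measurable assms(2)] by (simp add: vimage_def Int_def conj_commute)
qed

text \<open>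
  On a fine grid the positions of the nonzero increments determine the jump counts at the times in
  \<open>J\<close>, and the \<open>k\<close>-th nonzero increment is the \<open>k\<close>-th jump, so the product formula on the grid passes
  to the limit.
\<close>

lemma grid_joint_limit:
  assumes J: "finite J" "J \<subseteq> {0..T}" and T: "0 \<le> T" and B: "\<And>k. B k \<in> sets borel"
  shows "(\<lambda>n. prob {\<omega> \<in> space M. nonzeros (\<lambda>j. increment n j \<omega>) (cells n T) \<in> supports n T J A K}
        * (\<Prod>k = 1..K. jump_ratio n (B k)))
    \<longlonglongrightarrow> prob {\<omega> \<in> space M. (\<forall>t\<in>J. num_jumps t \<omega> \<in> A t) \<and> K \<le> num_jumps T \<omega> \<and> (\<forall>k\<in>{1..K}. mark k \<omega> \<in> B k)}"
proof -
  \<comment> \<open>The grid may see more than \<open>K\<close> nonzero increments; those of rank above \<open>K\<close> are left unconstrained.\<close>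
  define B' where "B' k = (if k \<le> K then B k else UNIV)" for k
  let ?S = "\<lambda>n \<omega>. nonzeros (\<lambda>j. increment n j \<omega>) (cells n T)"
  let ?P = "\<lambda>n \<omega>. ?S n \<omega> \<in> supports n T J A K \<and> (\<forall>j\<in>?S n \<omega>. increment n j \<omega> \<in> B' (rank_in (?S n \<omega>) j))"
  let ?Q = "\<lambda>\<omega>. (\<forall>t\<in>J. num_jumps t \<omega> \<in> A t) \<and> K \<le> num_jumps T \<omega> \<and> (\<forall>k\<in>{1..K}. mark k \<omega> \<in> B k)"
  have lev: "prob {\<omega> \<in> space M. ?P n \<omega>} = prob {\<omega> \<in> space M. ?S n \<omega> \<in> supports n T J A K} * (\<Prod>k = 1..K. jump_ratio n (B k))"
    "{\<omega> \<in> space M. ?P n \<omega>} \<in> events" for n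
  proof -
    interpret S: iid_steps M "increment n" "cells n T" "step_law n" by (rule iid_grid)
    have F: "supports n T J A K \<subseteq> {S. S \<subseteq> {..<cells n T} \<and> K \<le> card S}" by (auto simp: supports_def)
    have B': "B' k \<in> sets borel" for k
      using B by (simp add: B'_def)
    have B'_UNIV: "B' k = UNIV" if "K < k" for k
      using that by (simp add: B'_def)
    note S.marks_prob[where B = B', OF F B' B'_UNIV step_law_nonzero_pos]
    moreover have "(\<Prod>k = 1..K. measure (step_law n) (B' k - {0}) / measure (step_law n) (- {0})) = (\<Prod>k = 1..K. jump_ratio n (B k))"
      by (intro prod.cong refl) (auto simp: B'_def jump_ratio_def)
    ultimately show "prob {\<omega> \<in> space M. ?P n \<omega>} = prob {\<omega> \<in> space M. ?S n \<omega> \<in> supports n T J A K} * (\<Prod>k = 1..K. jump_ratio n (B k))"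
      "{\<omega> \<in> space M. ?P n \<omega>} \<in> events" by simp_all
  qed
  have "(\<lambda>n. prob {\<omega> \<in> space M. ?P n \<omega>}) \<longlonglongrightarrow> prob {\<omega> \<in> space M. ?Q \<omega>}"
  proof (rule prob_tendsto_of_eventually_eq)
    show "{\<omega> \<in> space M. ?P n \<omega>} \<in> events" for n by (rule lev)
    show "{\<omega> \<in> space M. ?Q \<omega>} \<in> events"
      using J T B num_jumps_in[OF T, of "{K..}"]
      by (intro sets.sets_Collect_conj counts_events marks_events) auto
    show "AE \<omega> in M. eventually (\<lambda>n. ?P n \<omega> = ?Q \<omega>) sequentially"
      using AE_good
    proof eventually_elim
      case (elim \<omega>)
      then interpret step_path "sample_path \<omega>" by (rule good_step_path)
      have "eventually (\<lambda>n. \<forall>t\<in>J. grid_count n t \<omega> = num_jumps t \<omega>) sequentially"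
        using J by (intro eventually_ball_finite ballI grid_count_eventually[OF elim]) auto
      with grid_jumps[OF T] show ?case
      proof eventually_elim
        case (elim n)
        have g: "\<omega> \<in> good" by fact
        have card: "card (?S n \<omega>) = num_jumps T \<omega>"
          using elim(1) g by (simp add: num_jumps_def)
        have size: "\<forall>j\<in>?S n \<omega>. increment n j \<omega> = jump_size (sample_path \<omega>) (rank_in (?S n \<omega>) j)"
          by (rule conjunct2[OF elim(1)])
        note counts = elim(2)
        have sub: "?S n \<omega> \<subseteq> {..<cells n T}" by (auto simp: nonzeros_def)
        have "card (?S n \<omega> \<inter> {..<cells n t}) = num_jumps t \<omega>" if "t \<in> J" for t
        proof -
          have "?S n \<omega> \<inter> {..<cells n t} = nonzeros (\<lambda>j. increment n j \<omega>) (cells n t)"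
            using cells_mono[of t T n] that J by (auto simp: nonzeros_def)
          then show ?thesis using counts that by (simp add: grid_count_def)
        qed
        then have supp: "?S n \<omega> \<in> supports n T J A K \<longleftrightarrow> K \<le> num_jumps T \<omega> \<and> (\<forall>t\<in>J. num_jumps t \<omega> \<in> A t)"
          using sub card by (simp add: supports_def)
        have image: "rank_in (?S n \<omega>) ` ?S n \<omega> = {1..num_jumps T \<omega>}"
          using bij_betw_rank[of "?S n \<omega>"] card by (simp add: bij_betw_def)
        have "(\<forall>j\<in>?S n \<omega>. increment n j \<omega> \<in> B' (rank_in (?S n \<omega>) j))
            \<longleftrightarrow> (\<forall>j\<in>?S n \<omega>. jump_size (sample_path \<omega>) (rank_in (?S n \<omega>) j) \<in> B' (rank_in (?S n \<omega>) j))"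
          by (intro ball_cong refl) (simp only: size[rule_format])
        also have "\<dots> \<longleftrightarrow> (\<forall>k\<in>{1..num_jumps T \<omega>}. jump_size (sample_path \<omega>) k \<in> B' k)"
          unfolding image[symmetric] by blast
        finally have incs: "(\<forall>j\<in>?S n \<omega>. increment n j \<omega> \<in> B' (rank_in (?S n \<omega>) j))
            \<longleftrightarrow> (\<forall>k\<in>{1..num_jumps T \<omega>}. jump_size (sample_path \<omega>) k \<in> B' k)" .
        have "(\<forall>k\<in>{1..num_jumps T \<omega>}. jump_size (sample_path \<omega>) k \<in> B' k) \<longleftrightarrow> (\<forall>k\<in>{1..K}. mark k \<omega> \<in> B k)"
          if "K \<le> num_jumps T \<omega>"
          using that g by (auto simp: B'_def mark_def)
        with supp incs show ?case by blast
      qed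
    qed
  qed
  then show ?thesis unfolding lev .
qed

text \<open>
  The law of the first jump, conditioned to occur up to time 1; by \<open>mark_law\<close> below it is the law of
  every jump. Up to time 1 there is a jump with probability \<open>1 - exp (- c)\<close>.
\<close>

definition jump_law :: "real set \<Rightarrow> real" where
  "jump_law B = prob {\<omega> \<in> space M. 1 \<le> num_jumps 1 \<omega> \<and> mark 1 \<omega> \<in> B} / (1 - exp (- c))"

text \<open>
  \<open>grid_joint_limit\<close> with a single jump expresses \<open>jump_ratio n B\<close> as a quotient of two convergent
  sequences, so the limit exists for every Borel set \<open>B\<close>.
\<close>

lemma jump_ratio_tendsto:
  assumes B: "B \<in> sets borel"
  shows "(\<lambda>n. jump_ratio n B) \<longlonglongrightarrow> jump_law B"
proof -
  let ?p = "\<lambda>n. prob {\<omega> \<in> space M. nonzeros (\<lambda>j. increment n j \<omega>) (cells n 1) \<in> supports n 1 {} (\<lambda>_. {}) 1}"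
  have lim: "(\<lambda>n. ?p n * jump_ratio n C) \<longlonglongrightarrow> prob {\<omega> \<in> space M. 1 \<le> num_jumps 1 \<omega> \<and> mark 1 \<omega> \<in> C}"
    if "C \<in> sets borel" for C
    using grid_joint_limit[of "{}" 1 "\<lambda>_. C" "\<lambda>_. {}" 1] that by simp
  have "prob {\<omega> \<in> space M. 1 \<le> num_jumps 1 \<omega>} = prob (space M - {\<omega> \<in> space M. num_jumps 1 \<omega> - num_jumps 0 \<omega> = 0})"
    by (rule arg_cong[where f = prob]) auto
  also have "\<dots> = 1 - prob {\<omega> \<in> space M. num_jumps 1 \<omega> - num_jumps 0 \<omega> = 0}"
    using num_jumps_in[of 1 "{0}"] by (intro prob_compl) simp
  also have "\<dots> = 1 - exp (- c)"
    by (subst jump_increment_prob) auto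
  finally have p: "?p \<longlonglongrightarrow> 1 - exp (- c)"
    using lim[of UNIV] by simp
  have pos: "0 < 1 - exp (- c)" using c_pos by simp
  have "(\<lambda>n. ?p n * jump_ratio n B / ?p n) \<longlonglongrightarrow> jump_law B"
    unfolding jump_law_def using pos by (intro tendsto_divide lim B p) auto
  moreover have "eventually (\<lambda>n. ?p n * jump_ratio n B / ?p n = jump_ratio n B) sequentially"
    using order_tendstoD(1)[OF p pos] by eventually_elim simp
  ultimately show ?thesis by (rule Lim_transform_eventually)
qed

lemma jump_law_UNIV [simp]: "jump_law UNIV = 1"
  using jump_ratio_tendsto[of UNIV] by (simp add: LIMSEQ_const_iff)

lemma joint_law_before:
  assumes J: "finite J" "J \<subseteq> {0..T}" and T: "0 \<le> T" and B: "\<And>k. B k \<in> sets borel"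
  shows "prob {\<omega> \<in> space M. (\<forall>t\<in>J. num_jumps t \<omega> \<in> A t) \<and> K \<le> num_jumps T \<omega> \<and> (\<forall>k\<in>{1..K}. mark k \<omega> \<in> B k)}
      = prob {\<omega> \<in> space M. (\<forall>t\<in>J. num_jumps t \<omega> \<in> A t) \<and> K \<le> num_jumps T \<omega>} * (\<Prod>k = 1..K. jump_law (B k))"
proof (rule LIMSEQ_unique)
  show "(\<lambda>n. prob {\<omega> \<in> space M. nonzeros (\<lambda>j. increment n j \<omega>) (cells n T) \<in> supports n T J A K}
        * (\<Prod>k = 1..K. jump_ratio n (B k)))
    \<longlonglongrightarrow> prob {\<omega> \<in> space M. (\<forall>t\<in>J. num_jumps t \<omega> \<in> A t) \<and> K \<le> num_jumps T \<omega> \<and> (\<forall>k\<in>{1..K}. mark k \<omega> \<in> B k)}"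
    by (rule grid_joint_limit[OF J T B])
  have "(\<lambda>n. prob {\<omega> \<in> space M. nonzeros (\<lambda>j. increment n j \<omega>) (cells n T) \<in> supports n T J A K})
    \<longlonglongrightarrow> prob {\<omega> \<in> space M. (\<forall>t\<in>J. num_jumps t \<omega> \<in> A t) \<and> K \<le> num_jumps T \<omega>}"
    using grid_joint_limit[OF J T, of "\<lambda>_. UNIV" A K] by simp
  then show "(\<lambda>n. prob {\<omega> \<in> space M. nonzeros (\<lambda>j. increment n j \<omega>) (cells n T) \<in> supports n T J A K}
        * (\<Prod>k = 1..K. jump_ratio n (B k)))
    \<longlonglongrightarrow> prob {\<omega> \<in> space M. (\<forall>t\<in>J. num_jumps t \<omega> \<in> A t) \<and> K \<le> num_jumps T \<omega>} * (\<Prod>k = 1..K. jump_law (B k))"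
    by (intro tendsto_mult tendsto_prod jump_ratio_tendsto B)
qed

text \<open>
  Almost surely there are at least \<open>K\<close> jumps up to time \<open>T\<close> once \<open>T\<close> is large, so this condition
  disappears from \<open>joint_law_before\<close> as \<open>T\<close> tends to infinity.
\<close>

lemma joint_law_initial:
  assumes J: "finite J" "J \<subseteq> {0..}" and B: "\<And>k. B k \<in> sets borel"
  shows "prob {\<omega> \<in> space M. (\<forall>t\<in>J. num_jumps t \<omega> \<in> A t) \<and> (\<forall>k\<in>{1..K}. mark k \<omega> \<in> B k)}
      = prob {\<omega> \<in> space M. \<forall>t\<in>J. num_jumps t \<omega> \<in> A t} * (\<Prod>k = 1..K. jump_law (B k))"
proof -
  define T0 where "T0 = Max (insert 0 J)"
  have T0: "0 \<le> T0" "J \<subseteq> {0..T0}" using J by (auto simp: T0_def)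
  define T where "T i = T0 + real i" for i :: nat
  have T: "0 \<le> T i" "J \<subseteq> {0..T i}" for i
    using T0 by (auto simp: T_def subset_eq intro: order_trans)
  have reach: "AE \<omega> in M. eventually (\<lambda>i. K \<le> num_jumps (T i) \<omega>) sequentially"
    using AE_good
  proof eventually_elim
    case (elim \<omega>)
    then interpret step_path "sample_path \<omega>" by (rule good_step_path)
    obtain t where t: "0 \<le> t" "jump_count (sample_path \<omega>) t = K" using jump_count_surj by blast
    obtain i0 :: nat where i0: "t \<le> real i0" using real_arch_simple by blast
    have "K \<le> num_jumps (T i) \<omega>" if "i0 \<le> i" for i
      using jump_count_mono[of t "T i"] t i0 that T0 elim by (simp add: num_jumps_def T_def)
    then show ?case unfolding eventually_sequentially by blast
  qed
  note count_ev = counts_events[OF J, of A]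
  have K_ev: "{\<omega> \<in> space M. K \<le> num_jumps (T i) \<omega>} \<in> events" for i
    using num_jumps_in[OF T(1), where A = "{K..}"] by simp
  have "(\<lambda>i. prob {\<omega> \<in> space M. (\<forall>t\<in>J. num_jumps t \<omega> \<in> A t) \<and> K \<le> num_jumps (T i) \<omega> \<and> (\<forall>k\<in>{1..K}. mark k \<omega> \<in> B k)})
    \<longlonglongrightarrow> prob {\<omega> \<in> space M. (\<forall>t\<in>J. num_jumps t \<omega> \<in> A t) \<and> (\<forall>k\<in>{1..K}. mark k \<omega> \<in> B k)}"
    using reach by (intro prob_tendsto_of_eventually_eq sets.sets_Collect_conj count_ev K_ev)
      (auto elim!: eventually_mono intro!: marks_events B)
  then have 1: "(\<lambda>i. prob {\<omega> \<in> space M. (\<forall>t\<in>J. num_jumps t \<omega> \<in> A t) \<and> K \<le> num_jumps (T i) \<omega>} * (\<Prod>k = 1..K. jump_law (B k)))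
    \<longlonglongrightarrow> prob {\<omega> \<in> space M. (\<forall>t\<in>J. num_jumps t \<omega> \<in> A t) \<and> (\<forall>k\<in>{1..K}. mark k \<omega> \<in> B k)}"
    by (subst (asm) joint_law_before[OF J(1) T(2,1) B])
  have "(\<lambda>i. prob {\<omega> \<in> space M. (\<forall>t\<in>J. num_jumps t \<omega> \<in> A t) \<and> K \<le> num_jumps (T i) \<omega>})
    \<longlonglongrightarrow> prob {\<omega> \<in> space M. \<forall>t\<in>J. num_jumps t \<omega> \<in> A t}"
    using reach by (intro prob_tendsto_of_eventually_eq sets.sets_Collect_conj count_ev K_ev)
      (auto elim!: eventually_mono)
  from LIMSEQ_unique[OF 1 tendsto_mult_right[OF this]] show ?thesis .
qed

lemma joint_law:
  assumes J: "finite J" "J \<subseteq> {0..}" and I: "finite I" "I \<subseteq> {1..}" and B: "\<And>k. k \<in> I \<Longrightarrow> B k \<in> sets borel"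
  shows "prob {\<omega> \<in> space M. (\<forall>t\<in>J. num_jumps t \<omega> \<in> A t) \<and> (\<forall>k\<in>I. mark k \<omega> \<in> B k)}
      = prob {\<omega> \<in> space M. \<forall>t\<in>J. num_jumps t \<omega> \<in> A t} * (\<Prod>k\<in>I. jump_law (B k))"
proof -
  define B' where "B' k = (if k \<in> I then B k else UNIV)" for k
  obtain K where K: "I \<subseteq> {1..K}"
    using I finite_nat_set_iff_bounded_le[of I] by fastforce
  have "(\<forall>k\<in>I. mark k \<omega> \<in> B k) \<longleftrightarrow> (\<forall>k\<in>{1..K}. mark k \<omega> \<in> B' k)" for \<omega>
    using K by (auto simp: B'_def)
  moreover have "prob {\<omega> \<in> space M. (\<forall>t\<in>J. num_jumps t \<omega> \<in> A t) \<and> (\<forall>k\<in>{1..K}. mark k \<omega> \<in> B' k)}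
      = prob {\<omega> \<in> space M. \<forall>t\<in>J. num_jumps t \<omega> \<in> A t} * (\<Prod>k = 1..K. jump_law (B' k))"
    by (rule joint_law_initial[OF J]) (auto simp: B'_def B)
  moreover have "(\<Prod>k = 1..K. jump_law (B' k)) = (\<Prod>k\<in>I. jump_law (B k))"
    using K by (intro prod.mono_neutral_cong_right) (auto simp: B'_def)
  ultimately show ?thesis by simp
qed

lemma marks_joint_law:
  assumes "finite I" "I \<subseteq> {1..}" "\<And>k. k \<in> I \<Longrightarrow> B k \<in> sets borel"
  shows "prob {\<omega> \<in> space M. \<forall>k\<in>I. mark k \<omega> \<in> B k} = (\<Prod>k\<in>I. jump_law (B k))"
  using joint_law[of "{}" I B "\<lambda>_. {}"] assms by (simp add: prob_space)

lemma mark_law: "1 \<le> k \<Longrightarrow> B \<in> sets borel \<Longrightarrow> prob {\<omega> \<in> space M. mark k \<omega> \<in> B} = jump_law B"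
  using marks_joint_law[of "{k}" "\<lambda>_. B"] by simp

lemma marks_indep: "indep_vars (\<lambda>_. borel) mark {1..}"
  unfolding indep_vars_def2 indep_sets_def
proof (intro conjI ballI allI impI)
  fix I A assume I: "I \<subseteq> {1..}" "I \<noteq> {}" "finite I" and A: "A \<in> (\<Pi> k\<in>I. {mark k -` B \<inter> space M |B. B \<in> sets borel})"
  have "\<exists>B. \<forall>k\<in>I. B k \<in> sets borel \<and> A k = mark k -` B k \<inter> space M"
    using A by (intro bchoice) (fastforce simp: Pi_iff)
  then obtain B where B: "\<And>k. k \<in> I \<Longrightarrow> B k \<in> sets borel" "\<And>k. k \<in> I \<Longrightarrow> A k = {\<omega> \<in> space M. mark k \<omega> \<in> B k}"
    by (auto simp: vimage_def Int_def conj_commute)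
  have "\<Inter> (A ` I) = {\<omega> \<in> space M. \<forall>k\<in>I. mark k \<omega> \<in> B k}"
    using I B by auto
  then have "prob (\<Inter> (A ` I)) = (\<Prod>k\<in>I. jump_law (B k))"
    using marks_joint_law[OF I(3,1) B(1)] by simp
  also have "\<dots> = (\<Prod>k\<in>I. prob (A k))"
    using I B mark_law by (intro prod.cong) auto
  finally show "prob (\<Inter> (A ` I)) = (\<Prod>k\<in>I. prob (A k))" .
qed auto

lemma counts_indep_marks:
  "indep_set
     (sets (vimage_algebra (space M) (\<lambda>\<omega>. \<lambda>t\<in>{0..}. num_jumps t \<omega>) (\<Pi>\<^sub>M t\<in>{0..}. count_space UNIV)))
     (sets (vimage_algebra (space M) (\<lambda>\<omega>. \<lambda>k\<in>{1..}. mark k \<omega>) (\<Pi>\<^sub>M k\<in>{1..}. borel)))"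
proof -
  let ?f = "\<lambda>\<omega>. \<lambda>t\<in>{0::real..}. num_jumps t \<omega>" and ?g = "\<lambda>\<omega>. \<lambda>k\<in>{1::nat..}. mark k \<omega>"
  let ?F = "{?f -` A \<inter> space M |A. A \<in> prod_algebra {0..} (\<lambda>_. count_space UNIV)}"
  let ?G = "{?g -` A \<inter> space M |A. A \<in> prod_algebra {1..} (\<lambda>_. borel)}"
  have "indep_set ?F ?G"
    unfolding indep_sets2_eq
  proof (intro conjI ballI subsetI)
    fix a assume "a \<in> ?F"
    then obtain J E where "finite J" "J \<subseteq> {0..}" "a = {\<omega> \<in> space M. \<forall>t\<in>J. num_jumps t \<omega> \<in> E t}"
      by (rule vimage_prod_algebraE) auto
    then show "a \<in> events" using counts_events by simp
  next
    fix b assume "b \<in> ?G"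
    then obtain I B where "finite I" "I \<subseteq> {1..}" "\<And>k. k \<in> I \<Longrightarrow> B k \<in> sets borel" "b = {\<omega> \<in> space M. \<forall>k\<in>I. mark k \<omega> \<in> B k}"
      by (rule vimage_prod_algebraE) auto
    then show "b \<in> events" using marks_events by simp
  next
    fix a b assume "a \<in> ?F" "b \<in> ?G"
    from \<open>a \<in> ?F\<close> obtain J E where a: "finite J" "J \<subseteq> {0..}" "a = {\<omega> \<in> space M. \<forall>t\<in>J. num_jumps t \<omega> \<in> E t}"
      by (rule vimage_prod_algebraE) auto
    from \<open>b \<in> ?G\<close> obtain I B where b: "finite I" "I \<subseteq> {1..}" "\<And>k. k \<in> I \<Longrightarrow> B k \<in> sets borel" "b = {\<omega> \<in> space M. \<forall>k\<in>I. mark k \<omega> \<in> B k}"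
      by (rule vimage_prod_algebraE) auto
    have "a \<inter> b = {\<omega> \<in> space M. (\<forall>t\<in>J. num_jumps t \<omega> \<in> E t) \<and> (\<forall>k\<in>I. mark k \<omega> \<in> B k)}"
      unfolding a b by auto
    also have "prob \<dots> = prob a * (\<Prod>k\<in>I. jump_law (B k))"
      unfolding a(3) by (rule joint_law[OF a(1,2) b(1-3)])
    also have "(\<Prod>k\<in>I. jump_law (B k)) = prob b"
      unfolding b(4) by (rule marks_joint_law[OF b(1-3), symmetric])
    finally show "prob (a \<inter> b) = prob a * prob b" .
  qed
  then have "indep_set (sigma_sets (space M) ?F) (sigma_sets (space M) ?G)"
    by (intro indep_set_sigma_sets Int_stable_vimage Int_stable_prod_algebra)
  moreover have "sets (vimage_algebra (space M) ?f (\<Pi>\<^sub>M t\<in>{0..}. count_space UNIV)) = sigma_sets (space M) ?F"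
    by (rule sets_vimage_algebra_PiM) auto
  moreover have "sets (vimage_algebra (space M) ?g (\<Pi>\<^sub>M k\<in>{1..}. borel)) = sigma_sets (space M) ?G"
    by (rule sets_vimage_algebra_PiM) auto
  ultimately show ?thesis by simp
qed

text \<open>
  The counting process and the jumps are read off from the paths of \<open>X\<close>, which is why the
  representation lives on the given probability space.
\<close>

lemma is_compound_poisson: "compound_poisson_process M X c"
  unfolding compound_poisson_process_def
proof (intro exI compound_poisson_representation.intro compound_poisson_representation_axioms.intro)
  show "poisson_process M num_jumps c" by (rule num_jumps_poisson_process)
  show "indep_vars (\<lambda>_. borel) mark {1..}" by (rule marks_indep)
  show "distr M borel (mark k) = distr M borel (mark 1)" if "1 \<le> k" for k
  proof (rule measure_eqI)
    fix A :: "real set" assume "A \<in> sets (distr M borel (mark k))"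
    then show "emeasure (distr M borel (mark k)) A = emeasure (distr M borel (mark 1)) A"
      using mark_law[OF that, of A] mark_law[of 1 A]
      by (simp add: emeasure_distr emeasure_eq_measure vimage_def Int_def conj_commute)
  qed simp
  show "AE \<omega> in M. 0 < mark k \<omega>" if "1 \<le> k" for k
    using AE_good by eventually_elim (use that step_path.jump_size_pos[OF good_step_path] in \<open>simp add: mark_def\<close>)
  show "AE \<omega> in M. \<forall>t\<ge>0. X t \<omega> = (\<Sum>k = 1..num_jumps t \<omega>. mark k \<omega>)"
    using AE_good
  proof eventually_elim
    case (elim \<omega>)
    then show ?case
      using step_path.sum_jump_size[OF good_step_path[OF elim]] by (simp add: num_jumps_def mark_def)
  qed
qed (rule counts_indep_marks)

end

section \<open>The dichotomy\<close>

theorem proposition1p1: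
  fixes M :: "'a measure" and X :: "real \<Rightarrow> 'a \<Rightarrow> real"
  assumes "subordinator M X"
    and "measure M {\<omega> \<in> space M. X 1 \<omega> = 0} < 1"
  shows "\<forall>\<tau> \<in> {first_passage_time X, sojourn_time X, last_exit_time X}.
    ((\<not> (\<exists>c>0. compound_poisson_process M X c)) \<longrightarrow>
       (\<forall>a>0. \<forall>r\<ge>0. exp_moment M a (\<tau> r) < \<infinity>)) \<and>
    (\<forall>c>0. compound_poisson_process M X c \<longrightarrow>
       (\<forall>a>0.
          ((\<exists>r\<ge>0. exp_moment M a (\<tau> r) < \<infinity>) \<longleftrightarrow> (\<forall>r\<ge>0. exp_moment M a (\<tau> r) < \<infinity>)) \<and>
          ((\<forall>r\<ge>0. exp_moment M a (\<tau> r) < \<infinity>) \<longleftrightarrow> a < c)))"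
proof (intro ballI conjI impI allI)
  interpret subordinator M X by fact
  let ?p = "prob {\<omega> \<in> space M. X 1 \<omega> = 0}"
  fix \<tau> assume \<tau>: "\<tau> \<in> {first_passage_time X, sojourn_time X, last_exit_time X}"
  {
    fix a r :: real
    assume no_cpp: "\<not> (\<exists>c>0. compound_poisson_process M X c)" and a: "0 < a" and r: "0 \<le> r"
    \<comment> \<open>An atom \<open>0 < p < 1\<close> would make \<open>X\<close> compound Poisson of rate \<open>- ln p\<close>.\<close>
    have "?p = 0"
    proof (rule ccontr)
      assume "?p \<noteq> 0"
      then have pos: "0 < ?p" by (simp add: zero_less_measure_iff)
      then have "lazy_subordinator M X (- ln ?p)"
        using assms(2) by unfold_locales auto
      then have "compound_poisson_process M X (- ln ?p)"
        by (rule lazy_subordinator.is_compound_poisson)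
      moreover have "0 < - ln ?p" using pos assms(2) by simp
      ultimately show False using no_cpp by blast
    qed
    then show "exp_moment M a (\<tau> r) < \<infinity>"
      by (intro exp_moment_finite[OF \<tau> a r]) (simp add: emeasure_eq_measure)
  }
  {
    fix c a :: real
    assume c: "0 < c" "compound_poisson_process M X c" and a: "0 < a"
    have fin: "exp_moment M a (\<tau> r) < \<infinity>" if "a < c" "0 \<le> r" for r
    proof (rule exp_moment_finite[OF \<tau> a that(2)])
      have "ennreal (exp a) * ennreal (exp (- c)) = ennreal (exp (a - c))"
        by (simp add: ennreal_mult[symmetric] exp_add[symmetric])
      also have "\<dots> < 1" using that by (simp add: ennreal_1[symmetric] ennreal_less_iff del: ennreal_1)
      finally show "ennreal (exp a) * emeasure M {\<omega> \<in> space M. X 1 \<omega> = 0} < 1"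
        using compound_poisson_zero_prob[OF c(2), of 1] by simp
    qed
    have inf: "exp_moment M a (\<tau> r) = \<infinity>" if "\<not> a < c" "0 \<le> r" for r
      using that by (intro exp_moment_infinite[OF \<tau> a that(2) _ c(2)]) simp
    show "(\<exists>r\<ge>0. exp_moment M a (\<tau> r) < \<infinity>) \<longleftrightarrow> (\<forall>r\<ge>0. exp_moment M a (\<tau> r) < \<infinity>)"
      using fin inf by (metis less_irrefl order_refl)
    show "(\<forall>r\<ge>0. exp_moment M a (\<tau> r) < \<infinity>) \<longleftrightarrow> a < c"
      using fin inf by (metis less_irrefl order_refl)
  }
qed

end
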